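(* Let $p\ge1$, let $n_0\ge0$, $n_1,\dots,n_p\ge1$ and $k\ge1$ be integers, $N_p=\{n_1,\dots,n_p\}$, $n=n_0+n_1+\dots+n_p$, and for $1\le\alpha\le p$ let $\widetilde J_\alpha=\{n_0+\dots+n_{\alpha-1}+1,\dots,n_0+\dots+n_\alpha\}$. Let $$D_p(N_p;n_0;0,0,k;q):=\mathrm{CT}\bigg(\prod_{\alpha=1}^p\ \prod_{\substack{i<j\\ i,j\in\widetilde J_\alpha}}(z_i-q^{k+1}z_j)(z_i^{-1}-q^kz_j^{-1})\prod_{1\le i<j\le n}\Big(\frac{z_i}{z_j};q\Big)_k\Big(q\frac{z_j}{z_i};q\Big)_k\bigg).$$ Then $$D_p(N_p;n_0;0,0,k;q)=\prod_{\alpha=1}^p[n_\alpha]_{q^{k+1}}!\;\frac{[kn+\max(N_p)]_q!}{[k]_q!^{\,n}}\;\frac{(1-q)^{\max(N_p)}}{\prod_{i=1}^{\max(N_p)}\left(1-q^iq^{k(n-m(i))}\right)},$$ where $m(i):=\sum_{\alpha:\,n_\alpha\ge i}(n_\alpha-i)$.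
   Context: $\mathrm{CT}$ denotes the constant term of a Laurent polynomial with respect to $z=(z_1,\dots,z_n)$, $q$ is an indeterminate, $(a;q)_k:=\prod_{m=0}^{k-1}(1-aq^m)$, $[m]_x:=(1-x^m)/(1-x)$ and $[m]_x!:=[1]_x[2]_x\cdots[m]_x$. $N_p$ is treated as a list (repetitions allowed) and $\max(N_p)=\max(n_1,\dots,n_p)$. *)

theory Defs
  imports
    "HOL-Computational_Algebra.Computational_Algebra"
    "HOL-Library.Poly_Mapping"
begin

type_synonym qfield = "rat poly fract"

definition q_ind :: qfield where
  "q_ind = Fract [:0, 1:] 1"

text \<open>
  An exponent vector is a finitely supported integer function, so the monomials form an abelian
  group and the monoid algebra over them is the ring of Laurent polynomials in the variables
  \<open>z\<^sub>0, z\<^sub>1, \<dots>\<close>.  An element that involves only \<open>z\<^sub>1, \<dots>, z\<^sub>n\<close> is a Laurent polynomial in these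
  variables, and its constant term does not depend on the ambient number of variables.
\<close>

type_synonym laurent = "(nat \<Rightarrow>\<^sub>0 int) \<Rightarrow>\<^sub>0 qfield"

definition lconst :: "qfield \<Rightarrow> laurent" where
  "lconst c = Poly_Mapping.single 0 c"

definition zpow :: "nat \<Rightarrow> int \<Rightarrow> laurent" where
  "zpow i e = Poly_Mapping.single (Poly_Mapping.single i e) 1"

definition zvar :: "nat \<Rightarrow> laurent" where
  "zvar i = zpow i 1"

definition zinv :: "nat \<Rightarrow> laurent" where
  "zinv i = zpow i (- 1)"

definition CT :: "laurent \<Rightarrow> qfield" where
  "CT f = Poly_Mapping.lookup f 0"

definition qpoch :: "'a::comm_ring_1 \<Rightarrow> 'a \<Rightarrow> nat \<Rightarrow> 'a" where
  "qpoch a x k = (\<Prod>m<k. 1 - a * x ^ m)"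

definition qnum :: "'a::field \<Rightarrow> nat \<Rightarrow> 'a" where
  "qnum x m = (1 - x ^ m) / (1 - x)"

definition qfact :: "'a::field \<Rightarrow> nat \<Rightarrow> 'a" where
  "qfact x m = (\<Prod>i=1..m. qnum x i)"

text \<open>
  The function \<open>ns\<close> lists the block sizes: \<open>ns 0\<close> is \<open>n\<^sub>0\<close>, and \<open>ns 1, \<dots>, ns p\<close> is the list \<open>N\<^sub>p\<close>.
\<close>

definition block :: "(nat \<Rightarrow> nat) \<Rightarrow> nat \<Rightarrow> nat set" where
  "block ns \<alpha> = {(\<Sum>\<beta><\<alpha>. ns \<beta>) + 1 .. (\<Sum>\<beta>\<le>\<alpha>. ns \<beta>)}"

definition pairs :: "nat set \<Rightarrow> (nat \<times> nat) set" where
  "pairs A = {(i, j). i \<in> A \<and> j \<in> A \<and> i < j}"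

definition D_const :: "nat \<Rightarrow> (nat \<Rightarrow> nat) \<Rightarrow> nat \<Rightarrow> qfield" where
  "D_const p ns k = CT (
     (\<Prod>\<alpha>=1..p. \<Prod>(i, j)\<in>pairs (block ns \<alpha>).
        (zvar i - lconst (q_ind ^ (k + 1)) * zvar j) * (zinv i - lconst (q_ind ^ k) * zinv j))
     * (\<Prod>(i, j)\<in>pairs {1..\<Sum>\<alpha>\<le>p. ns \<alpha>}.
        qpoch (zvar i * zinv j) (lconst q_ind) k
        * qpoch (lconst q_ind * (zvar j * zinv i)) (lconst q_ind) k))"

text \<open>The truncated difference is harmless, since the sum ranges only over \<open>ns \<alpha> \<ge> i\<close>.\<close>

definition m_sum :: "nat \<Rightarrow> (nat \<Rightarrow> nat) \<Rightarrow> nat \<Rightarrow> nat" where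
  "m_sum p ns i = (\<Sum>\<alpha> | \<alpha> \<in> {1..p} \<and> i \<le> ns \<alpha>. ns \<alpha> - i)"

end

theory Submission
  imports Defs
begin

text \<open>
  Write \<open>k'\<close> for \<open>k + 1\<close> inside a block and \<open>k\<close> otherwise.  Inside a block, everything but the product of the
  \<open>z\<^sub>i - q\<^sup>k\<^sup>+\<^sup>1 z\<^sub>j\<close> is antisymmetric, so this product may be replaced by \<open>[n\<^sub>\<alpha>]!\<close> times the staircase monomial.
  It remains to find the constant term of the product of \<open>(z\<^sub>i/z\<^sub>j; q)\<^sub>k\<^sub>' (q z\<^sub>j/z\<^sub>i; q)\<^sub>k\<close> over \<open>i < j\<close>, where the
  variables outside the blocks count as blocks of size one.

  Rescaling variables by \<open>q\<close> rotates the blocks cyclically, so a largest block, of size \<open>r + 1\<close>, may be placed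
  last.  Let \<open>y\<close> be its last variable, replace the exponent of \<open>(q z\<^sub>y/z\<^sub>i; q)\<^sub>k\<close> by \<open>a\<close>, and view the constant term as a polynomial
  in \<open>t = q\<^sup>a\<close>.  Its degree is at most \<open>d = k (n - 1) + r\<close> and at \<open>t = 1\<close> the variable \<open>y\<close> disappears.  At
  \<open>t = q\<^sup>-\<^sup>h\<close> with \<open>1 \<le> h \<le> d\<close> the factors in question become \<open>1 / \<Prod>\<^sub>m\<^sub>\<le>\<^sub>h (1 - 1 / (q\<^sup>m z\<^sub>i))\<close> up to scaling, and taking the constant term
  in \<open>z\<^sub>i\<close> is evaluation on the grid \<open>q\<^sup>-\<^sup>1, \<dots>, q\<^sup>-\<^sup>h\<close> plus a functional that only sees exponents \<open>\<le> -h\<close>.  Expanding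
  over the set of variables that are evaluated, every term vanishes, as the remaining grid values are too far
  apart or the degree in the other variables is too large.  This determines the polynomial, and its value at
  \<open>t = q\<^sup>k\<close> gives a recursion in \<open>n\<close>.
\<close>

section \<open>The indeterminate\<close>

lemma q_ind_power: "q_ind ^ m = Fract (monom 1 m) 1"
proof (induction m)
  case 0
  then show ?case by (simp add: One_fract_def monom_0 one_pCons)
next
  case (Suc m)
  then show ?case
    by (simp add: q_ind_def monom_Suc)
qed

lemma q_ind_nonzero [simp]: "q_ind \<noteq> 0"
  by (simp add: q_ind_def Zero_fract_def eq_fract)

text \<open>By comparison of degrees, q is not a root of unity. Hence all denominators 1 - q^l with
  l > 0 are nonzero and the grid points q^-h are pairwise distinct.\<close>

lemma q_ind_power_eq_1_iff [simp]: "q_ind ^ m = 1 \<longleftrightarrow> m = 0"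
proof
  assume "q_ind ^ m = 1"
  then have "monom (1 :: rat) m = 1"
    by (simp add: q_ind_power One_fract_def eq_fract)
  then have "degree (monom (1 :: rat) m) = 0"
    by simp
  then show "m = 0"
    by (simp add: degree_monom_eq)
qed simp

lemma q_ind_powi_eq_1_iff [simp]: "q_ind powi m = 1 \<longleftrightarrow> m = 0"
  by (auto simp: power_int_def field_simps)

lemma q_ind_powi_inject [simp]: "q_ind powi a = q_ind powi b \<longleftrightarrow> a = b"
proof -
  have "q_ind powi a = q_ind powi b \<longleftrightarrow> q_ind powi (a - b) = 1"
    by (auto simp: power_int_diff simp del: q_ind_powi_eq_1_iff)
  then show ?thesis by simp
qed

section \<open>Linear functionals on Laurent polynomials\<close>

type_synonym expo = "nat \<Rightarrow>\<^sub>0 int"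

abbreviation lookup where "lookup \<equiv> Poly_Mapping.lookup"
abbreviation keys where "keys \<equiv> Poly_Mapping.keys"
abbreviation single where "single \<equiv> Poly_Mapping.single"

text \<open>A functional is encoded by its values \<open>\<theta>\<close> on monomials, so that
  constant terms, evaluations at powers of q and mixtures of both all have the form
  \<open>lin \<theta>\<close>.\<close>

definition lin :: "(expo \<Rightarrow> qfield) \<Rightarrow> laurent \<Rightarrow> qfield" where
  "lin \<theta> f = (\<Sum>e\<in>keys f. lookup f e * \<theta> e)"

lemma lin_superset:
  assumes "finite A" "keys f \<subseteq> A"
  shows "lin \<theta> f = (\<Sum>e\<in>A. lookup f e * \<theta> e)"
  unfolding lin_def using assms by (intro sum.mono_neutral_left) (auto simp: in_keys_iff)

lemma lin_zero [simp]: "lin \<theta> 0 = 0"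
  by (simp add: lin_def)

lemma lin_single [simp]: "lin \<theta> (single e c) = c * \<theta> e"
  by (simp add: lin_def)

lemma lin_add: "lin \<theta> (f + g) = lin \<theta> f + lin \<theta> g"
proof -
  have fin: "finite (keys f \<union> keys g)" by simp
  have "lin \<theta> (f + g) = (\<Sum>e\<in>keys f \<union> keys g. lookup (f + g) e * \<theta> e)"
    by (rule lin_superset[OF fin keys_add])
  also have "\<dots> = (\<Sum>e\<in>keys f \<union> keys g. lookup f e * \<theta> e) + (\<Sum>e\<in>keys f \<union> keys g. lookup g e * \<theta> e)"
    by (simp add: lookup_add algebra_simps sum.distrib)
  also have "(\<Sum>e\<in>keys f \<union> keys g. lookup f e * \<theta> e) = lin \<theta> f"
    by (rule lin_superset[symmetric]) auto
  also have "(\<Sum>e\<in>keys f \<union> keys g. lookup g e * \<theta> e) = lin \<theta> g"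
    by (rule lin_superset[symmetric]) auto
  finally show ?thesis .
qed

lemma lin_uminus: "lin \<theta> (- f) = - lin \<theta> f"
  by (simp add: lin_def sum_negf)

lemma lin_diff: "lin \<theta> (f - g) = lin \<theta> f - lin \<theta> g"
  using lin_add[of \<theta> f "- g"] by (simp add: lin_uminus)

lemma lin_cong: "(\<And>e. e \<in> keys f \<Longrightarrow> \<theta> e = \<theta>' e) \<Longrightarrow> lin \<theta> f = lin \<theta>' f"
  by (simp add: lin_def)

lemma lin_functional_scale: "lin (\<lambda>e. c * \<theta> e) f = c * lin \<theta> f"
  by (simp add: lin_def sum_distrib_left algebra_simps)

lemma lin_functional_diff: "lin (\<lambda>e. \<theta> e - \<theta>' e) f = lin \<theta> f - lin \<theta>' f"
  by (simp add: lin_def sum_subtractf algebra_simps)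

lemma lin_functional_sum: "lin (\<lambda>e. \<Sum>x\<in>A. \<theta> x e) f = (\<Sum>x\<in>A. lin (\<theta> x) f)"
  unfolding lin_def by (subst sum.swap) (simp add: sum_distrib_left)

lemma laurent_induct [case_names zero single add]:
  assumes "P 0" "\<And>e c. P (single e c)" "\<And>f g. P f \<Longrightarrow> P g \<Longrightarrow> P (f + g)"
  shows "P (f :: laurent)"
proof (induction f rule: Poly_Mapping.update_induct)
  case const
  show ?case by (rule assms(1))
next
  case (update f a b)
  have "Poly_Mapping.update a b f = single a b + f"
    using update(1)
    by (intro poly_mapping_eqI) (auto simp: lookup_update lookup_add lookup_single in_keys_iff when_def)
  then show ?case using assms update by metis
qed

text \<open>Moves a monomial factor from the argument into the functional, where it becomes a
  translation of exponents.\<close>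

lemma lin_single_mult: "lin \<theta> (single d c * f) = c * lin (\<lambda>e. \<theta> (e + d)) f"
proof (induction f rule: laurent_induct)
  case (single e c)
  then show ?case by (simp add: mult_single add.commute mult.assoc)
next
  case (add f g)
  then show ?case by (simp add: lin_add distrib_left)
qed simp

lemma CT_eq_lin: "CT f = lin (\<lambda>e. if e = 0 then 1 else 0) f"
  by (auto simp: CT_def lin_def if_distrib sum.delta' in_keys_iff cong: if_cong)

text \<open>The elementary factor 1 - c z_i/z_j from which all products below are built.\<close>

definition rfac :: "qfield \<Rightarrow> nat \<Rightarrow> nat \<Rightarrow> laurent" where
  "rfac c i j = 1 - single (single i 1 - single j 1) c"

lemma lin_rfac: "lin \<theta> (rfac c i j * f) = lin \<theta> f - c * lin (\<lambda>e. \<theta> (e + (single i 1 - single j 1))) f"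
  by (simp add: rfac_def left_diff_distrib lin_diff lin_single_mult)

section \<open>Weights of monomials\<close>

text \<open>The sign of \<open>N\<close> makes it a cost: for additive \<open>w\<close> the costs of
  the factors of a product add up.\<close>

definition bounded_below :: "(expo \<Rightarrow> int) \<Rightarrow> int \<Rightarrow> laurent \<Rightarrow> bool" where
  "bounded_below w N f \<longleftrightarrow> (\<forall>e\<in>keys f. - N \<le> w e)"

lemma bounded_belowD: "bounded_below w N f \<Longrightarrow> e \<in> keys f \<Longrightarrow> - N \<le> w e"
  by (simp add: bounded_below_def)

lemma bounded_below_mult:
  assumes "\<And>a b. w (a + b) = w a + w b" "bounded_below w M f" "bounded_below w N g"
  shows "bounded_below w (M + N) (f * g)"
  unfolding bounded_below_def
proof
  fix e assume "e \<in> keys (f * g)"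
  then obtain a b where "e = a + b" "a \<in> keys f" "b \<in> keys g"
    using keys_mult[of f g] by auto
  then show "- (M + N) \<le> w e"
    using assms(1)[of a b] bounded_belowD[OF assms(2)] bounded_belowD[OF assms(3)] by fastforce
qed

lemma bounded_below_one: "w 0 = 0 \<Longrightarrow> bounded_below w 0 1"
  by (simp add: bounded_below_def)

lemma bounded_below_prod:
  assumes "\<And>a b. w (a + b) = w a + w b" "\<And>x. x \<in> A \<Longrightarrow> bounded_below w (N x) (f x)"
  shows "bounded_below w (\<Sum>x\<in>A. N x) (\<Prod>x\<in>A. f x)"
proof -
  have "w 0 = 0" using assms(1)[of 0 0] by simp
  then have one: "bounded_below w 0 1" by (rule bounded_below_one)
  show ?thesis
    using assms(2)
  proof (induction A rule: infinite_finite_induct)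
    case (insert x A)
    have "bounded_below w (N x + (\<Sum>x\<in>A. N x)) (f x * (\<Prod>x\<in>A. f x))"
      using insert by (intro bounded_below_mult[OF assms(1)]) auto
    then show ?case using insert by simp
  qed (simp_all add: one)
qed

lemma bounded_below_rfac:
  assumes "w 0 = 0" "0 \<le> N" "- N \<le> w (single i 1 - single j 1)"
  shows "bounded_below w N (rfac c i j)"
  unfolding bounded_below_def
proof
  fix e assume "e \<in> keys (rfac c i j)"
  then have "e = 0 \<or> e = single i 1 - single j 1"
    using keys_diff[of 1 "single (single i 1 - single j 1 :: expo) c"]
    by (auto simp: rfac_def split: if_splits)
  then show "- N \<le> w e" using assms by auto
qed

section \<open>Monomial substitutions\<close>

text \<open>One notion for the two substitutions needed: rescaling variables by q (through
  \<open>\<kappa>\<close>) and permuting them (through \<open>\<phi>\<close>).\<close>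

definition msub :: "(expo \<Rightarrow> qfield) \<Rightarrow> (expo \<Rightarrow> expo) \<Rightarrow> laurent \<Rightarrow> laurent" where
  "msub \<kappa> \<phi> f = (\<Sum>e\<in>keys f. single (\<phi> e) (lookup f e * \<kappa> e))"

lemma msub_superset:
  assumes "finite A" "keys f \<subseteq> A"
  shows "msub \<kappa> \<phi> f = (\<Sum>e\<in>A. single (\<phi> e) (lookup f e * \<kappa> e))"
  unfolding msub_def using assms by (intro sum.mono_neutral_left) (auto simp: in_keys_iff)

lemma msub_zero [simp]: "msub \<kappa> \<phi> 0 = 0"
  by (simp add: msub_def)

lemma msub_single [simp]: "msub \<kappa> \<phi> (single e c) = single (\<phi> e) (c * \<kappa> e)"
  by (simp add: msub_def)

lemma msub_add: "msub \<kappa> \<phi> (f + g) = msub \<kappa> \<phi> f + msub \<kappa> \<phi> g"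
proof -
  let ?A = "keys f \<union> keys g"
  have "msub \<kappa> \<phi> (f + g) = (\<Sum>e\<in>?A. single (\<phi> e) (lookup (f + g) e * \<kappa> e))"
    by (rule msub_superset) (auto simp: keys_add)
  also have "\<dots> = (\<Sum>e\<in>?A. single (\<phi> e) (lookup f e * \<kappa> e)) + (\<Sum>e\<in>?A. single (\<phi> e) (lookup g e * \<kappa> e))"
    by (simp add: lookup_add distrib_right single_add sum.distrib)
  also have "\<dots> = msub \<kappa> \<phi> f + msub \<kappa> \<phi> g"
    using msub_superset[of ?A f \<kappa> \<phi>] msub_superset[of ?A g \<kappa> \<phi>] by simp
  finally show ?thesis .
qed

lemma msub_diff: "msub \<kappa> \<phi> (f - g) = msub \<kappa> \<phi> f - msub \<kappa> \<phi> g"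
  using msub_add[of \<kappa> \<phi> "f - g" g] by simp

locale monomial_hom =
  fixes \<kappa> :: "expo \<Rightarrow> qfield" and \<phi> :: "expo \<Rightarrow> expo"
  assumes \<kappa>_0: "\<kappa> 0 = 1" and \<kappa>_add: "\<And>a b. \<kappa> (a + b) = \<kappa> a * \<kappa> b"
    and \<phi>_add: "\<And>a b. \<phi> (a + b) = \<phi> a + \<phi> b"
    and \<phi>_eq_0: "\<And>a. \<phi> a = 0 \<longleftrightarrow> a = 0"
begin

lemma msub_one [simp]: "msub \<kappa> \<phi> 1 = 1"
  using msub_single[of \<kappa> \<phi> 0 1] \<phi>_eq_0[of 0] by (simp add: \<kappa>_0)

lemma msub_mult: "msub \<kappa> \<phi> (f * g) = msub \<kappa> \<phi> f * msub \<kappa> \<phi> g"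
proof (induction f rule: laurent_induct)
  case (single e c)
  show ?case
    by (induction g rule: laurent_induct)
      (simp_all add: mult_single \<phi>_add \<kappa>_add mult_ac msub_add distrib_left distrib_right)
next
  case (add f g)
  then show ?case by (simp add: msub_add distrib_right)
qed simp

lemma msub_prod: "msub \<kappa> \<phi> (\<Prod>x\<in>A. f x) = (\<Prod>x\<in>A. msub \<kappa> \<phi> (f x))"
  by (induction A rule: infinite_finite_induct) (simp_all add: msub_mult)

lemma lin_msub: "lin \<theta> (msub \<kappa> \<phi> f) = lin (\<lambda>e. \<kappa> e * \<theta> (\<phi> e)) f"
  by (induction f rule: laurent_induct) (simp_all add: lin_add msub_add)

lemma CT_msub: "CT (msub \<kappa> \<phi> f) = CT f"
  unfolding CT_eq_lin lin_msub by (rule lin_cong) (simp add: \<phi>_eq_0 \<kappa>_0)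

end

section \<open>Admissible grid points\<close>

text \<open>The order is read off from the labels, so that rotating the blocks changes
  \<open>bl\<close> but no variable index.\<close>

definition prec :: "(nat \<Rightarrow> nat) \<Rightarrow> nat \<Rightarrow> nat \<Rightarrow> bool" where
  "prec bl i j \<longleftrightarrow> bl i < bl j \<or> bl i = bl j \<and> i < j"

lemma prec_total: "i \<noteq> j \<Longrightarrow> prec bl i j \<or> prec bl j i"
  by (auto simp: prec_def)

lemma prec_asym: "prec bl i j \<Longrightarrow> \<not> prec bl j i"
  by (auto simp: prec_def)

lemma prec_irrefl [simp]: "\<not> prec bl i i"
  by (auto simp: prec_def)

text \<open>List \<open>S\<close> by increasing \<open>m\<close>. The first value pays
  \<open>k + a + u\<close>, every later step pays \<open>k + a\<close> plus the change of the
  potential \<open>u\<close>, and these changes telescope. The induction removes an element with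
  maximal \<open>m\<close>.\<close>

lemma chain_bound:
  fixes m a u :: "nat \<Rightarrow> int"
  assumes "finite S" "S \<noteq> {}"
    and base: "\<And>x. x \<in> S \<Longrightarrow> k + a x + u x \<le> m x"
    and step: "\<And>x y. x \<in> S \<Longrightarrow> y \<in> S \<Longrightarrow> x \<noteq> y \<Longrightarrow> m y \<le> m x \<Longrightarrow> m y + k + a x + u x - u y \<le> m x"
  shows "\<exists>x\<in>S. k * int (card S) + (\<Sum>y\<in>S. a y) + u x \<le> m x \<and> (\<forall>y\<in>S. m y \<le> m x)"
  using assms
proof (induction "card S" arbitrary: S)
  case (Suc c S)
  obtain x where x: "x \<in> S" "\<And>y. y \<in> S \<Longrightarrow> m y \<le> m x"
  proof -
    have "Max (m ` S) \<in> m ` S" using Suc.prems(1,2) by simp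
    then obtain x where "x \<in> S" "Max (m ` S) = m x" by auto
    then show thesis using that[of x] Suc.prems(1) by (metis Max_ge finite_imageI imageI)
  qed
  define S' where "S' = S - {x}"
  have S': "finite S'" "c = card S'" "S = insert x S'" "x \<notin> S'"
    using Suc.prems(1) Suc.hyps(2) x(1) by (auto simp: S'_def)
  show ?case
  proof (cases "S' = {}")
    case True
    then have "S = {x}" using S'(3) by simp
    then show ?thesis using Suc.prems(3)[OF x(1)] by simp
  next
    case False
    have "\<exists>y\<in>S'. k * int (card S') + (\<Sum>y\<in>S'. a y) + u y \<le> m y \<and> (\<forall>z\<in>S'. m z \<le> m y)"
      by (rule Suc.hyps(1)[OF S'(2) S'(1) False]) (simp_all add: S'(3) Suc.prems(3,4))
    then obtain y where y: "y \<in> S'" "k * int (card S') + (\<Sum>y\<in>S'. a y) + u y \<le> m y"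
      by auto
    have "m y + k + a x + u x - u y \<le> m x"
      using y(1) x S' by (intro Suc.prems(4)) auto
    then have "k * int (card S) + (\<Sum>y\<in>S. a y) + u x \<le> m x"
      using y(2) S' by (simp add: algebra_simps)
    then show ?thesis using x by blast
  qed
qed simp

lemma sum_of_bool_card:
  "finite S \<Longrightarrow> (\<Sum>x\<in>S. of_bool (P x)) = int (card {x \<in> S. P x})"
  by (simp add: of_bool_def sum.If_cases Int_def)

text \<open>\<open>start\<close> and \<open>gap\<close> express that no factor vanishes at the point
  z_i = q^-m(i) for i in \<open>S\<close>, with a last variable of block \<open>b\<close> placed at
  q^-1: the differences of the exponents must avoid certain intervals.\<close>

context
  fixes S :: "nat set" and m :: "nat \<Rightarrow> int" and bl :: "nat \<Rightarrow> nat" and b k :: nat and h :: int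
  assumes k: "1 \<le> k" and S: "finite S" and h: "1 \<le> h" "\<And>i. i \<in> S \<Longrightarrow> m i \<le> h"
    and start: "\<And>i. i \<in> S \<Longrightarrow> int k + of_bool (bl i = b) + 1 \<le> m i"
    and gap: "\<And>i j. i \<in> S \<Longrightarrow> j \<in> S \<Longrightarrow> prec bl i j \<Longrightarrow>
      m j + int k + of_bool (bl i = bl j) \<le> m i \<or> m i + int k + 1 \<le> m j"
begin

text \<open>Reading the grid values upwards, every step into block \<open>b\<close> costs one more than \<open>k\<close>, because
  \<open>b\<close> is the last block.\<close>

lemma grid_bound_top:
  assumes top: "\<And>i. i \<in> S \<Longrightarrow> bl i \<le> b"
  shows "int k * int (card S) + 1 + int (card {i \<in> S. bl i = b}) \<le> h"
proof (cases "S = {}")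
  case False
  have "\<exists>x\<in>S. int k * int (card S) + (\<Sum>y\<in>S. of_bool (bl y = b)) + 1 \<le> m x \<and> (\<forall>y\<in>S. m y \<le> m x)"
  proof (rule chain_bound[OF S False])
    fix x y assume xy: "x \<in> S" "y \<in> S" "x \<noteq> y" "m y \<le> m x"
    then consider "prec bl x y" | "prec bl y x" using prec_total by blast
    then show "m y + int k + of_bool (bl x = b) + 1 - 1 \<le> m x"
    proof cases
      case 1
      then show ?thesis
        using gap[OF xy(1,2) 1] xy(4) k top[OF xy(1)] top[OF xy(2)]
        by (auto simp: prec_def of_bool_def split: if_splits)
    next
      case 2
      then show ?thesis
        using gap[OF xy(2,1) 2] xy(4) k by (auto simp: of_bool_def split: if_splits)
    qed
  qed (use start in force)
  then obtain x where "x \<in> S" "int k * int (card S) + (\<Sum>y\<in>S. of_bool (bl y = b)) + 1 \<le> m x"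
    by blast
  then show ?thesis using h(2)[of x] unfolding sum_of_bool_card[OF S] by linarith
qed (use h in simp)

text \<open>Between two visits to the elements of the block of \<open>j\<close> below \<open>j\<close>, the grid values either step
  inside the block or go upwards in the order at least once.  A potential that is \<open>1\<close> above \<open>j\<close> keeps track of this.\<close>

lemma grid_bound_below:
  assumes "j \<notin> S"
  shows "int k * int (card S) + int (card {i \<in> S. bl i = bl j \<and> i < j}) \<le> h"
proof (cases "S = {}")
  case False
  have "\<exists>x\<in>S. int k * int (card S) + (\<Sum>y\<in>S. of_bool (bl y = bl j \<and> y < j)) + of_bool (prec bl j x) \<le> m x
      \<and> (\<forall>y\<in>S. m y \<le> m x)"
  proof (rule chain_bound[OF S False])
    fix x assume "x \<in> S"
    from start[OF this] show "int k + of_bool (bl x = bl j \<and> x < j) + of_bool (prec bl j x) \<le> m x"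
      by (auto simp: of_bool_def prec_def split: if_splits)
  next
    fix x y assume xy: "x \<in> S" "y \<in> S" "x \<noteq> y" "m y \<le> m x"
    have ne: "x \<noteq> j" "y \<noteq> j" using xy assms by auto
    consider "prec bl x y" | "prec bl y x" using prec_total xy(3) by blast
    then show "m y + int k + of_bool (bl x = bl j \<and> x < j) + of_bool (prec bl j x) - of_bool (prec bl j y) \<le> m x"
    proof cases
      case 1
      then show ?thesis
        using gap[OF xy(1,2) 1] xy(4) ne k
        by (auto simp: of_bool_def prec_def split: if_splits)
    next
      case 2
      then show ?thesis
        using gap[OF xy(2,1) 2] xy(4) ne k
        by (auto simp: of_bool_def prec_def split: if_splits)
    qed
  qed
  then obtain x where "x \<in> S" "int k * int (card S) + (\<Sum>y\<in>S. of_bool (bl y = bl j \<and> y < j))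
      + of_bool (prec bl j x) \<le> m x"
    by blast
  then show ?thesis using h(2)[of x] unfolding sum_of_bool_card[OF S] by (auto simp: of_bool_def split: if_splits)
qed (use h in simp)

end

lemma degree_smult_linear: "degree (smult a [:b, c:]) \<le> 1"
  by (rule order.trans[OF degree_smult_le]) simp

section \<open>The coefficients of the $q$-binomial theorem\<close>

text \<open>At \<open>t = q\<^sup>a\<close> this is the coefficient of \<open>u\<^sup>e\<close> in \<open>(u; q)\<^sub>a\<close>.\<close>

definition qcoeff :: "int \<Rightarrow> qfield poly" where
  "qcoeff e = (if e < 0 then 0 else \<Prod>l<nat e. smult (1 / (1 - q_ind ^ Suc l)) [:- (q_ind ^ l), 1:])"

lemma degree_qcoeff: "int (degree (qcoeff e)) \<le> max 0 e"
proof (cases "e < 0")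
  case False
  have "degree (qcoeff e) \<le> (\<Sum>l<nat e. 1)"
    unfolding qcoeff_def if_not_P[OF False]
    by (rule order.trans[OF degree_prod_sum_le], simp, rule sum_mono, simp only: o_def degree_smult_linear)
  then show ?thesis using False by simp
qed (simp add: qcoeff_def)

lemma qcoeff_neg [simp]: "e < 0 \<Longrightarrow> qcoeff e = 0"
  by (simp add: qcoeff_def)

lemma qcoeff_at_1: "poly (qcoeff e) 1 = of_bool (e = 0)"
proof (cases "e > 0")
  case True
  then show ?thesis
    by (auto simp: qcoeff_def poly_prod intro!: bexI[of _ 0])
qed (auto simp: qcoeff_def)

text \<open>The coefficient form of (u; q)_(a+1) = (u; q)_a (1 - q^a u), with q^a replaced by an
  arbitrary \<open>t\<close>.\<close>

lemma qcoeff_shift: "poly (qcoeff e) (q_ind * t) = poly (qcoeff e) t - t * poly (qcoeff (e - 1)) t"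
proof (cases "e \<le> 0")
  case True
  then show ?thesis by (cases "e = 0") (auto simp: qcoeff_def)
next
  case False
  then obtain n where e: "e = int (Suc n)"
    by (metis not_le zero_less_imp_eq_int Suc_pred)
  let ?d = "\<lambda>l. 1 - q_ind ^ Suc l"
  let ?c = "(\<Prod>l<n. (t - q_ind ^ l) / ?d l)"
  have d: "?d l \<noteq> 0" for l
    using q_ind_power_eq_1_iff[of "Suc l"] by simp
  have p: "poly (qcoeff (int m)) x = (\<Prod>l<m. (x - q_ind ^ l) / ?d l)" for m x
    by (simp add: qcoeff_def poly_prod diff_divide_distrib)
  have prd: "(\<Prod>l<n. q_ind * t - q_ind ^ Suc l) = q_ind ^ n * (\<Prod>l<n. t - q_ind ^ l)"
  proof -
    have "(\<Prod>l<n. q_ind * t - q_ind ^ Suc l) = (\<Prod>l<n. q_ind * (t - q_ind ^ l))"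
      by (simp add: right_diff_distrib)
    then show ?thesis by (simp only: prod.distrib prod_constant card_lessThan)
  qed
  have "poly (qcoeff e) (q_ind * t) = (\<Prod>l<Suc n. q_ind * t - q_ind ^ l) / (\<Prod>l<Suc n. ?d l)"
    unfolding e p by (rule prod_dividef)
  also have "(\<Prod>l<Suc n. q_ind * t - q_ind ^ l) = (q_ind * t - 1) * (\<Prod>l<n. q_ind * t - q_ind ^ Suc l)"
    by (subst prod.lessThan_Suc_shift) simp
  also have "\<dots> / (\<Prod>l<Suc n. ?d l) = ?c * (q_ind ^ n * (q_ind * t - 1) / ?d n)"
    unfolding prd by (simp add: prod_dividef)
  also have "q_ind ^ n * (q_ind * t - 1) / ?d n = (t - q_ind ^ n) / ?d n - t"
    using d[of n] by (simp add: field_simps)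
  also have "?c * \<dots> = poly (qcoeff e) t - t * poly (qcoeff (e - 1)) t"
    using p[of "Suc n" t] p[of n t] unfolding e by (simp add: algebra_simps)
  finally show ?thesis .
qed

text \<open>For \<open>e > -h\<close> the left-hand side is the coefficient of \<open>u\<^sup>e\<close> in \<open>1 / \<Prod>(1 - u / q\<^sup>m)\<close>, where
  \<open>1 \<le> m \<le> h\<close>, and the right-hand side is its partial fraction expansion.\<close>

lemma qcoeff_at_negative_power:
  assumes "1 \<le> h"
  obtains w where "\<And>e. - int h < e \<Longrightarrow>
    poly (qcoeff e) (q_ind powi (- int h)) = (\<Sum>m\<in>{1..h}. w m * q_ind powi (- (int m * e)))"
proof -
  \<comment> \<open>At x = q^e this is the q-binomial coefficient of e + h - 1 over h - 1. Its zeros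
    at -h < e < 0 extend the expansion to these negative exponents, where \<open>qcoeff e\<close> is
    0.\<close>
  define R :: "qfield poly" where
    "R = (\<Prod>l\<in>{1..<h}. smult (1 / (1 - q_ind ^ l)) [:1, - (q_ind ^ l):])"
  have deg: "degree R \<le> h - 1"
  proof -
    have "degree R \<le> (\<Sum>l\<in>{1..<h}. 1)"
      unfolding R_def
      by (rule order.trans[OF degree_prod_sum_le], simp, rule sum_mono, simp only: o_def degree_smult_linear)
    then show ?thesis by simp
  qed
  have R: "poly R (q_ind powi e) = (\<Prod>l\<in>{1..<h}. (1 - q_ind powi (e + int l)) / (1 - q_ind ^ l))" for e
    by (simp add: R_def poly_prod power_int_add mult_ac diff_divide_distrib)
  have main: "poly (qcoeff e) (q_ind powi (- int h)) = q_ind powi (- (int h * e)) * poly R (q_ind powi e)"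
    if "- int h < e" for e
  proof (cases "e < 0")
    case True
    have "nat (- e) \<in> {1..<h}" using True that by auto
    moreover have "q_ind powi (e + int (nat (- e))) = 1" using True by simp
    ultimately have "poly R (q_ind powi e) = 0"
      unfolding R by (intro prod_zero) (auto intro!: bexI[of _ "nat (- e)"])
    then show ?thesis using True by simp
  next
    case False
    define n where "n = nat e"
    have e: "e = int n" using False by (simp add: n_def)
    have d: "1 - q_ind ^ l \<noteq> 0" if "l \<ge> 1" for l
      using q_ind_power_eq_1_iff[of l] that by simp
    let ?f = "\<lambda>a. \<Prod>l\<in>{1..a}. 1 - q_ind ^ l"
    have f: "?f a \<noteq> 0" for a using d by auto
    have split: "(\<Prod>l\<in>{1..a}. 1 - q_ind ^ (c + l)) = ?f (c + a) / ?f c" for a c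
    proof -
      have "?f (c + a) = ?f c * (\<Prod>l\<in>{1..a}. 1 - q_ind ^ (c + l))"
        by (induction a) simp_all
      then show ?thesis using f by simp
    qed
    have "poly R (q_ind powi e) = (\<Prod>l\<in>{1..h - 1}. 1 - q_ind ^ (n + l)) / ?f (h - 1)"
    proof -
      have *: "{1..<h} = {1..h - 1}" using assms by auto
      show ?thesis
        unfolding R prod_dividef * e
        by (simp flip: of_nat_add)
    qed
    also have "\<dots> = ?f (n + (h - 1)) / (?f n * ?f (h - 1))"
      unfolding split by simp
    also have "\<dots> = (\<Prod>l\<in>{1..n}. 1 - q_ind ^ ((h - 1) + l)) / ?f n"
      unfolding split by (simp add: add.commute)
    also have "\<dots> = (\<Prod>l<n. 1 - q_ind ^ (h + l)) / (\<Prod>l<n. 1 - q_ind ^ Suc l)"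
    proof -
      have "(\<Prod>l\<in>{1..n}. g l) = (\<Prod>l<n. g (Suc l))" for g :: "nat \<Rightarrow> qfield"
        by (rule prod.reindex_bij_witness[of _ Suc "\<lambda>l. l - 1"]) auto
      then show ?thesis using assms by simp
    qed
    finally have RR: "poly R (q_ind powi e) = (\<Prod>l<n. 1 - q_ind ^ (h + l)) / (\<Prod>l<n. 1 - q_ind ^ Suc l)" .
    have pw: "(q_ind powi (- int h)) ^ n = q_ind powi (- (int h * e))"
      unfolding e by (metis mult_minus_left power_int_mult power_int_of_nat)
    have "poly (qcoeff e) (q_ind powi (- int h)) =
        (\<Prod>l<n. q_ind powi (- int h) - q_ind ^ l) / (\<Prod>l<n. 1 - q_ind ^ Suc l)"
      unfolding e by (simp add: qcoeff_def poly_prod diff_divide_distrib flip: prod_dividef)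
    also have "(\<Prod>l<n. q_ind powi (- int h) - q_ind ^ l) = (\<Prod>l<n. q_ind powi (- int h) * (1 - q_ind ^ (h + l)))"
      by (intro prod.cong refl) (simp add: right_diff_distrib power_add power_int_minus)
    also have "\<dots> = q_ind powi (- (int h * e)) * (\<Prod>l<n. 1 - q_ind ^ (h + l))"
      unfolding prod.distrib prod_constant card_lessThan pw ..
    finally show ?thesis using RR by simp
  qed
  show thesis
  \<comment> \<open>The factor q^(-he) turns the term of degree i of \<open>R\<close> at q^e into a
    multiple of q^(-(h-i)e), so m = h - i runs through 1, ..., h.\<close>
  proof (rule that[of "\<lambda>m. coeff R (h - m)"])
    fix e :: int assume e: "- int h < e"
    have "poly R (q_ind powi e) = (\<Sum>i\<le>h - 1. coeff R i * (q_ind powi e) ^ i)"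
      unfolding poly_altdef
      using deg by (intro sum.mono_neutral_left) (auto simp: coeff_eq_0)
    also have "q_ind powi (- (int h * e)) * \<dots> = (\<Sum>i\<le>h - 1. coeff R i * q_ind powi (- (int (h - i) * e)))"
      unfolding sum_distrib_left
    proof (intro sum.cong refl)
      fix i assume "i \<in> {..h - 1}"
      then have *: "- (int (h - i) * e) = - (int h * e) + e * int i"
        using assms by (simp add: of_nat_diff algebra_simps)
      have "(q_ind powi e) ^ i = q_ind powi (e * int i)"
        by (simp add: power_int_mult)
      then show "q_ind powi (- (int h * e)) * (coeff R i * (q_ind powi e) ^ i)
          = coeff R i * q_ind powi (- (int (h - i) * e))"
        unfolding * by (subst power_int_add) (simp_all add: mult_ac)
    qed
    also have "\<dots> = (\<Sum>m\<in>{1..h}. coeff R (h - m) * q_ind powi (- (int m * e)))"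
      using assms by (intro sum.reindex_bij_witness[of _ "\<lambda>m. h - m" "\<lambda>i. h - i"]) auto
    finally show "poly (qcoeff e) (q_ind powi (- int h)) = (\<Sum>m\<in>{1..h}. coeff R (h - m) * q_ind powi (- (int m * e)))"
      using main[OF e] by simp
  qed
qed

section \<open>The weight function\<close>

text \<open>In the usual notation \<open>pfac i j u v\<close> is \<open>(z\<^sub>i/z\<^sub>j; q)\<^sub>u (q z\<^sub>j/z\<^sub>i; q)\<^sub>v\<close>.\<close>

definition pfac :: "nat \<Rightarrow> nat \<Rightarrow> nat \<Rightarrow> nat \<Rightarrow> laurent" where
  "pfac i j u v = (\<Prod>l<u. rfac (q_ind ^ l) i j) * (\<Prod>l<v. rfac (q_ind ^ Suc l) j i)"

definition wt :: "nat \<Rightarrow> (nat \<Rightarrow> nat) \<Rightarrow> nat set \<Rightarrow> laurent" where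
  "wt k bl V = (\<Prod>(i, j)\<in>{(i, j) \<in> V \<times> V. prec bl i j}. pfac i j (k + of_bool (bl i = bl j)) k)"

lemma lookup_ratio [simp]:
  "lookup (single i 1 - single j (1 :: int)) x = of_bool (x = i) - of_bool (x = j)"
  by (auto simp: lookup_minus lookup_single)

lemma wt_insert:
  assumes "finite V" "y \<notin> V" "\<And>i. i \<in> V \<Longrightarrow> prec bl i y"
  shows "wt k bl (insert y V) = wt k bl V * (\<Prod>i\<in>V. pfac i y (k + of_bool (bl i = bl y)) k)"
proof -
  have *: "{(i, j) \<in> insert y V \<times> insert y V. prec bl i j}
      = {(i, j) \<in> V \<times> V. prec bl i j} \<union> (\<lambda>i. (i, y)) ` V"
    using assms prec_asym by auto
  have "finite {(i, j) \<in> V \<times> V. prec bl i j}"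
    by (rule finite_subset[of _ "V \<times> V"]) (use assms in auto)
  then show ?thesis
    unfolding wt_def * using assms
    by (subst prod.union_disjoint) (auto simp: prod.reindex inj_on_def)
qed

lemma bounded_below_pfac:
  assumes add: "\<And>a b. w (a + b) = w a + w b"
  shows "bounded_below w (int u * max 0 (- w (single i 1 - single j 1))
    + int v * max 0 (w (single i 1 - single j 1))) (pfac i j u v)"
proof -
  have 0: "w 0 = 0" using add[of 0 0] by simp
  have neg: "w (single j 1 - single i 1) = - w (single i 1 - single j 1)"
    using add[of "single j 1 - single i 1" "single i 1 - single j 1"] 0 by simp
  have "bounded_below w (\<Sum>l<u. max 0 (- w (single i 1 - single j 1))) (\<Prod>l<u. rfac (q_ind ^ l) i j)"
    by (intro bounded_below_prod[OF add] bounded_below_rfac) (use 0 in auto)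
  moreover have "bounded_below w (\<Sum>l<v. max 0 (w (single i 1 - single j 1))) (\<Prod>l<v. rfac (q_ind ^ Suc l) j i)"
    by (intro bounded_below_prod[OF add] bounded_below_rfac) (use 0 neg in auto)
  ultimately show ?thesis
    unfolding pfac_def using bounded_below_mult[OF add] by simp
qed

lemma bounded_below_wt:
  assumes add: "\<And>a b. w (a + b) = w a + w b"
  shows "bounded_below w (\<Sum>(i, j)\<in>{(i, j) \<in> V \<times> V. prec bl i j}.
    int (k + of_bool (bl i = bl j)) * max 0 (- w (single i 1 - single j 1))
      + int k * max 0 (w (single i 1 - single j 1))) (wt k bl V)"
  unfolding wt_def case_prod_unfold
  by (intro bounded_below_prod[OF add] bounded_below_pfac[OF add])

text \<open>A weight that is zero on all ratios z_i/z_j costs nothing in any factor; this applies to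
  \<open>w\<close> and to its negative.\<close>

lemma wt_homogeneous:
  fixes w :: "expo \<Rightarrow> int"
  assumes add: "\<And>a b. w (a + b) = w a + w b"
    and w: "\<And>i j. i \<in> V \<Longrightarrow> j \<in> V \<Longrightarrow> w (single i 1 - single j 1) = 0"
    and e: "e \<in> keys (wt k bl V)"
  shows "w e = 0"
proof (rule order_antisym)
  have "bounded_below w 0 (wt k bl V)"
    using bounded_below_wt[OF add, where V = V and bl = bl and k = k] w by (simp add: case_prod_unfold)
  then show "0 \<le> w e" using e bounded_belowD by fastforce
  have "bounded_below (\<lambda>e. - w e) 0 (wt k bl V)"
    using bounded_below_wt[where w = "\<lambda>e. - w e" and V = V and bl = bl and k = k] add w by (simp add: case_prod_unfold)
  then show "w e \<le> 0" using e bounded_belowD by fastforce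
qed

lemma wt_total_degree:
  assumes "finite V" "e \<in> keys (wt k bl V)"
  shows "(\<Sum>i\<in>V. lookup e i) = 0"
  by (rule wt_homogeneous[where w = "\<lambda>e. \<Sum>i\<in>V. lookup e i", OF _ _ assms(2)])
    (use assms in \<open>simp_all add: lookup_add sum.distrib sum_subtractf\<close>)

lemma wt_support:
  assumes "e \<in> keys (wt k bl V)" "x \<notin> V"
  shows "lookup e x = 0"
  by (rule wt_homogeneous[where w = "\<lambda>e. lookup e x", OF _ _ assms(1)])
    (use assms in \<open>auto simp: lookup_add\<close>)

section \<open>Adding a variable to the last block\<close>

text \<open>The hypothesis says that \<open>\<theta>\<close> cannot distinguish c z_i/z_j from 1.
  This holds for functionals that evaluate z_i and z_j at points with c z_i = z_j, whatever they do
  with the other variables.\<close>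

lemma lin_vanishing_factor:
  assumes "\<And>e. \<theta> e = c * \<theta> (e + (single i 1 - single j 1))" "rfac c i j dvd f"
  shows "lin \<theta> f = 0"
proof -
  obtain g where f: "f = rfac c i j * g" using assms(2) by (elim dvdE)
  have "lin \<theta> f = lin \<theta> g - lin (\<lambda>e. c * \<theta> (e + (single i 1 - single j 1))) g"
    unfolding f lin_rfac lin_functional_scale ..
  also have "(\<lambda>e. c * \<theta> (e + (single i 1 - single j 1))) = \<theta>"
    by (rule ext) (rule assms(1)[symmetric])
  finally show ?thesis by simp
qed

text \<open>The variable \<open>y\<close> is about to be added behind \<open>V\<close>. In
  \<open>largest\<close> the \<open>Suc\<close> counts \<open>y\<close> itself: its completed block
  is at least as large as every other.\<close>

locale last_variable =
  fixes k y :: nat and V :: "nat set" and bl :: "nat \<Rightarrow> nat"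
  assumes k: "1 \<le> k" and V: "finite V" "y \<notin> V" and last: "\<And>i. i \<in> V \<Longrightarrow> prec bl i y"
    and largest: "\<And>i. i \<in> V \<Longrightarrow> card {j \<in> V. bl j = bl i} \<le> Suc (card {j \<in> V. bl j = bl y})"
begin

text \<open>The weight with \<open>y\<close> included but without the factors (q z_y/z_i; q)_k,
  whose length is to become a free parameter.\<close>

definition half_wt :: laurent where
  "half_wt = (\<Prod>i\<in>V. \<Prod>l<k + of_bool (bl i = bl y). rfac (q_ind ^ l) i y) * wt k bl V"

lemma wt_insert_half_wt:
  "wt k bl (insert y V) = (\<Prod>i\<in>V. \<Prod>l<k. rfac (q_ind ^ Suc l) y i) * half_wt"
  by (subst wt_insert) (use V last in \<open>simp_all add: half_wt_def pfac_def prod.distrib mult_ac\<close>)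

lemma rfac_dvd_half_wt:
  "i \<in> V \<Longrightarrow> l < k + of_bool (bl i = bl y) \<Longrightarrow> rfac (q_ind ^ l) i y dvd half_wt"
  "i \<in> V \<Longrightarrow> j \<in> V \<Longrightarrow> prec bl i j \<Longrightarrow> l < k + of_bool (bl i = bl j) \<Longrightarrow> rfac (q_ind ^ l) i j dvd half_wt"
  "i \<in> V \<Longrightarrow> j \<in> V \<Longrightarrow> prec bl i j \<Longrightarrow> l < k \<Longrightarrow> rfac (q_ind ^ Suc l) j i dvd half_wt"
proof -
  have dvd: "f x dvd prod f A" if "finite A" "x \<in> A" for f :: "'b \<Rightarrow> laurent" and x A
    using that by (rule dvd_prod_eqI[OF _ _ refl])
  show "rfac (q_ind ^ l) i y dvd half_wt" if "i \<in> V" "l < k + of_bool (bl i = bl y)" for i l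
    unfolding half_wt_def
    by (rule dvd_mult2, rule dvd_trans[OF dvd[of "{..<k + of_bool (bl i = bl y)}" l "\<lambda>l. rfac (q_ind ^ l) i y"]])
      (use that V dvd[of V i "\<lambda>i. \<Prod>l<k + of_bool (bl i = bl y). rfac (q_ind ^ l) i y"] in auto)
  have fin: "finite {(i, j) \<in> V \<times> V. prec bl i j}"
    by (rule finite_subset[of _ "V \<times> V"]) (use V in auto)
  have pfac: "pfac i j (k + of_bool (bl i = bl j)) k dvd half_wt" if "i \<in> V" "j \<in> V" "prec bl i j" for i j
    unfolding half_wt_def wt_def
    using dvd[OF fin, of "(i, j)" "\<lambda>(i, j). pfac i j (k + of_bool (bl i = bl j)) k"] that
    by (intro dvd_mult) simp
  show "rfac (q_ind ^ l) i j dvd half_wt"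
    if "i \<in> V" "j \<in> V" "prec bl i j" "l < k + of_bool (bl i = bl j)" for i j l
    by (rule dvd_trans[OF _ pfac[OF that(1-3)]])
      (use that(4) dvd[of "{..<k + of_bool (bl i = bl j)}" l "\<lambda>l. rfac (q_ind ^ l) i j"] in \<open>simp add: pfac_def\<close>)
  show "rfac (q_ind ^ Suc l) j i dvd half_wt"
    if "i \<in> V" "j \<in> V" "prec bl i j" "l < k" for i j l
    by (rule dvd_trans[OF _ pfac[OF that(1-3)]])
      (use that(4) dvd[of "{..<k}" l "\<lambda>l. rfac (q_ind ^ Suc l) j i"] in \<open>simp add: pfac_def\<close>)
qed

text \<open>The functional evaluates the variables in \<open>S\<close> at \<open>q\<^sup>-\<^sup>m\<close> and \<open>z\<^sub>y\<close> at \<open>q\<^sup>-\<^sup>1\<close>.  Either two grid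
  values meet a zero of a factor, or all monomials have too large a degree in the remaining variables.\<close>

lemma grid_term_vanishes:
  fixes h :: nat and m :: "nat \<Rightarrow> nat" and z :: "int \<Rightarrow> qfield"
  assumes h: "1 \<le> h" "h \<le> k * card V + card {j \<in> V. bl j = bl y}"
    and S: "S \<subseteq> V" and m: "\<And>i. i \<in> S \<Longrightarrow> m i \<in> {1..h}" "m y = 1"
    and z: "\<And>e. - int h < e \<Longrightarrow> z e = 0"
  shows "lin (\<lambda>e. q_ind powi (- (\<Sum>i\<in>insert y S. int (m i) * lookup e i)) * (\<Prod>j\<in>V - S. z (lookup e j)))
    half_wt = 0" (is "lin ?\<theta> _ = 0")
proof (rule ccontr)
  assume nz: "lin ?\<theta> half_wt \<noteq> 0"
  have finS: "finite S" and yS: "y \<notin> S" using S V by (auto intro: finite_subset)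
  \<comment> \<open>At the grid points 1 - q^l z_i/z_j is zero exactly when l + m(j) = m(i), so a
    nonzero value excludes this for every factor of \<open>half_wt\<close>.\<close>
  have val: "int l + int (m j) \<noteq> int (m i)"
    if "rfac (q_ind ^ l) i j dvd half_wt" "i \<in> insert y S" "j \<in> insert y S" for i j l
  proof
    assume eq: "int l + int (m j) = int (m i)"
    have "lin ?\<theta> half_wt = 0"
    proof (rule lin_vanishing_factor[OF _ that(1)])
      fix e :: expo
      let ?e = "e + (single i 1 - single j 1)"
      have L: "lookup ?e x = lookup e x + of_bool (x = i) - of_bool (x = j)" for x
        unfolding lookup_add lookup_ratio by simp
      have "(\<Sum>x\<in>insert y S. int (m x) * lookup ?e x)
          = (\<Sum>x\<in>insert y S. int (m x) * lookup e x) + (\<Sum>x\<in>insert y S. int (m x) * of_bool (x = i))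
            - (\<Sum>x\<in>insert y S. int (m x) * of_bool (x = j))"
        unfolding L by (simp only: distrib_left right_diff_distrib sum.distrib sum_subtractf)
      also have "\<dots> = (\<Sum>x\<in>insert y S. int (m x) * lookup e x) + int (m i) - int (m j)"
        using that(2,3) finS by (simp add: of_bool_def if_distrib sum.delta cong: if_cong)
      finally have "- (\<Sum>x\<in>insert y S. int (m x) * lookup e x)
          = int l + - (\<Sum>x\<in>insert y S. int (m x) * lookup ?e x)"
        using eq by simp
      moreover have "(\<Prod>j\<in>V - S. z (lookup ?e j)) = (\<Prod>j\<in>V - S. z (lookup e j))"
        using that(2,3) V by (intro prod.cong refl) (auto simp: L)
      moreover have shift: "q_ind powi (int l + x) = q_ind ^ l * q_ind powi x" for x
        by (simp add: power_int_add)
      ultimately show "?\<theta> e = q_ind ^ l * ?\<theta> ?e"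
        by (simp only: shift mult.assoc)
    qed
    then show False using nz by simp
  qed
  have gap: "int (m j) + int k + of_bool (bl i = bl j) \<le> int (m i) \<or> int (m i) + int k + 1 \<le> int (m j)"
    if ij: "i \<in> S" "j \<in> S" "prec bl i j" for i j
  proof (cases "m j \<le> m i")
    have ijV: "i \<in> V" "j \<in> V" using ij S by auto
    case True
    have "\<not> m i - m j < k + of_bool (bl i = bl j)"
      using val[OF rfac_dvd_half_wt(2), of i j "m i - m j"] ij ijV True by auto
    then show ?thesis using True by (auto simp: of_bool_def split: if_splits)
  next
    case False
    have ijV: "i \<in> V" "j \<in> V" using ij S by auto
    have "\<not> m j - m i - 1 < k"
      using val[OF rfac_dvd_half_wt(3), of i j "m j - m i - 1"] ij ijV False by auto
    then show ?thesis using False by auto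
  qed
  have start: "int k + of_bool (bl i = bl y) + 1 \<le> int (m i)" if i: "i \<in> S" for i
  proof -
    have "i \<in> V" using i S by auto
    then have "\<not> m i - 1 < k + of_bool (bl i = bl y)"
      using val[OF rfac_dvd_half_wt(1), of i "m i - 1"] i m(1)[OF i] m(2) by auto
    then show ?thesis using m(1)[OF i] by (auto simp: of_bool_def split: if_splits)
  qed
  have k': "1 \<le> k" and h': "(1 :: int) \<le> int h" "\<And>i. i \<in> S \<Longrightarrow> int (m i) \<le> int h"
    using k h m(1) by auto
  have top: "bl i \<le> bl y" if "i \<in> S" for i
    using last[OF subsetD[OF S that]] by (auto simp: prec_def)
  have B1: "k * card S + 1 + card {i \<in> S. bl i = bl y} \<le> h"
    using grid_bound_top[where bl = bl and b = "bl y" and m = "\<lambda>i. int (m i)", OF k' finS h' start gap top] by (subst of_nat_le_iff[symmetric, where 'a = int]) simp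
  have B2: "k * card S + card {i \<in> S. bl i = bl j \<and> i < j} \<le> h" if "j \<notin> S" for j
    using grid_bound_below[where bl = bl and b = "bl y" and m = "\<lambda>i. int (m i)", OF k' finS h' start gap that] by (subst of_nat_le_iff[symmetric, where 'a = int]) simp
  \<comment> \<open>With \<open>S = V\<close> the bound \<open>B1\<close> would exceed the upper
    bound assumed for \<open>h\<close> by one.\<close>
  have "S \<noteq> V" using B1 h by auto
  define T where "T = V - S"
  have T: "finite T" "T \<noteq> {}" "S \<inter> T = {}" "y \<notin> T" "V = S \<union> T"
    using V S \<open>S \<noteq> V\<close> by (auto simp: T_def)
  \<comment> \<open>\<open>N j\<close> counts the factors pairing z_j with an evaluated variable
    that can lower the exponent of z_j. Pairs inside \<open>T\<close> leave the total degree in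
    \<open>T\<close> unchanged and pairs with \<open>y\<close> can only raise it, so the sum of the
    \<open>N j\<close> bounds how negative this degree gets.\<close>
  define N where "N j = k * card S + card {i \<in> S. bl i = bl j \<and> i < j}" for j
  have strict: "\<exists>j\<in>T. N j < h"
  proof (cases "\<exists>j\<in>T. bl j = bl y")
    case True
    then obtain j where j: "j \<in> T" "bl j = bl y" by blast
    have "card {i \<in> S. bl i = bl j \<and> i < j} \<le> card {i \<in> S. bl i = bl y}"
      using j finS by (intro card_mono) auto
    then show ?thesis using B1 j by (auto simp: N_def intro!: bexI[of _ j])
  next
    \<comment> \<open>Now the part of the block of \<open>y\<close> in \<open>V\<close> is evaluated
      completely. The elements of \<open>S\<close> before \<open>j\<close> in its block omit
      \<open>j\<close>, so by \<open>largest\<close> there are no more of them than in the block of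
      \<open>y\<close>, and \<open>B1\<close> is strong enough.\<close>
    case False
    obtain j where j: "j \<in> T" using T by blast
    have "{i \<in> S. bl i = bl y} = {i \<in> V. bl i = bl y}" using False T by auto
    moreover have "card {i \<in> S. bl i = bl j \<and> i < j} < card {i \<in> V. bl i = bl j}"
      using j T V by (intro psubset_card_mono) auto
    ultimately have "card {i \<in> S. bl i = bl j \<and> i < j} \<le> card {i \<in> S. bl i = bl y}"
      using largest[of j] j T by auto
    then show ?thesis using B1 j by (auto simp: N_def intro!: bexI[of _ j])
  qed
  have sum_less: "(\<Sum>j\<in>T. int (N j)) < int h * int (card T)"
  proof -
    have "(\<Sum>j\<in>T. N j) < (\<Sum>j\<in>T. h)"
      using strict B2 T by (intro sum_strict_mono_ex1) (auto simp: N_def)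
    then have "int (\<Sum>j\<in>T. N j) < int (\<Sum>j\<in>T. h)" by linarith
    then show ?thesis by (simp add: mult.commute)
  qed
  define w :: "expo \<Rightarrow> int" where "w e = (\<Sum>j\<in>T. lookup e j)" for e
  have w_add: "w (a + b) = w a + w b" for a b
    by (simp add: w_def lookup_add sum.distrib)
  have w_ratio: "w (single i 1 - single j 1) = of_bool (i \<in> T) - of_bool (j \<in> T)" for i j
    using T(1) by (simp add: w_def sum_subtractf of_bool_def sum.delta)
  have "bounded_below w ((\<Sum>i\<in>V. \<Sum>l<k + of_bool (bl i = bl y). 0) + (\<Sum>j\<in>T. int (N j))) half_wt"
    unfolding half_wt_def
  proof (intro bounded_below_mult[OF w_add] bounded_below_prod[OF w_add] bounded_below_rfac)
    show "w 0 = 0" by (simp add: w_def)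
    show "- 0 \<le> w (single i 1 - single y 1)" for i
      using T by (simp add: w_ratio)
    let ?P = "{(i, j) \<in> V \<times> V. prec bl i j}"
    let ?c = "\<lambda>i j. of_bool (i \<in> S \<and> j \<in> T) :: int"
    have cut: "max 0 (- w (single i 1 - single j 1)) = ?c i j" "max 0 (w (single i 1 - single j 1)) = ?c j i"
      if "i \<in> V" "j \<in> V" for i j
      using T that by (auto simp: w_ratio of_bool_def)
    have finP: "finite ?P" by (rule finite_subset[of _ "V \<times> V"]) (use V in auto)
    have "(\<Sum>(i, j)\<in>?P. int (k + of_bool (bl i = bl j)) * max 0 (- w (single i 1 - single j 1))
        + int k * max 0 (w (single i 1 - single j 1)))
      = (\<Sum>(i, j)\<in>?P. int (k + of_bool (bl i = bl j)) * ?c i j + int k * ?c j i)"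
      by (intro sum.cong refl) (auto simp: cut)
    also have "\<dots> = (\<Sum>(i, j)\<in>?P. int (k + of_bool (bl i = bl j)) * ?c i j)
        + (\<Sum>(i, j)\<in>?P. int k * ?c j i)"
      by (simp add: case_prod_unfold sum.distrib)
    also have "(\<Sum>(i, j)\<in>?P. int k * ?c j i) = (\<Sum>(i, j)\<in>{(i, j) \<in> V \<times> V. prec bl j i}. int k * ?c i j)"
      by (rule sum.reindex_bij_witness[of _ prod.swap prod.swap]) auto
    also have "(\<Sum>(i, j)\<in>?P. int (k + of_bool (bl i = bl j)) * ?c i j)
        = (\<Sum>(i, j)\<in>V \<times> V. of_bool (prec bl i j) * int (k + of_bool (bl i = bl j)) * ?c i j)"
      by (rule sum.mono_neutral_cong_left) (use V in auto)
    also have "(\<Sum>(i, j)\<in>{(i, j) \<in> V \<times> V. prec bl j i}. int k * ?c i j)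
        = (\<Sum>(i, j)\<in>V \<times> V. of_bool (prec bl j i) * int k * ?c i j)"
      by (rule sum.mono_neutral_cong_left) (use V in auto)
    also have "(\<Sum>(i, j)\<in>V \<times> V. of_bool (prec bl i j) * int (k + of_bool (bl i = bl j)) * ?c i j) + \<dots>
        = (\<Sum>(i, j)\<in>V \<times> V. of_bool (prec bl i j) * int (k + of_bool (bl i = bl j)) * ?c i j
            + of_bool (prec bl j i) * int k * ?c i j)"
      by (simp add: case_prod_unfold sum.distrib)
    \<comment> \<open>For i in \<open>S\<close> and j in \<open>T\<close> exactly one of the two
      orders holds; either way k factors can lower z_j, and one more when both lie in one block with
      i < j.\<close>
    also have "\<dots> = (\<Sum>(i, j)\<in>S \<times> T. int k + of_bool (bl i = bl j \<and> i < j))"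
    proof (rule sum.mono_neutral_cong_right)
      show "\<forall>x\<in>V \<times> V - S \<times> T. (case x of (i, j) \<Rightarrow>
          of_bool (prec bl i j) * int (k + of_bool (bl i = bl j)) * ?c i j + of_bool (prec bl j i) * int k * ?c i j) = 0"
      proof
        fix x assume x: "x \<in> V \<times> V - S \<times> T"
        obtain i j where ij: "x = (i, j)" by (cases x)
        then have "\<not> (i \<in> S \<and> j \<in> T)" using x by auto
        then have "?c i j = 0" by (simp only: of_bool_eq_0_iff not_False_eq_True)
        then show "(case x of (i, j) \<Rightarrow> of_bool (prec bl i j) * int (k + of_bool (bl i = bl j)) * ?c i j
            + of_bool (prec bl j i) * int k * ?c i j) = 0"
          by (simp only: ij split_conv mult_zero_right add_0_right)
      qed
      show "(case x of (i, j) \<Rightarrow>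
          of_bool (prec bl i j) * int (k + of_bool (bl i = bl j)) * ?c i j + of_bool (prec bl j i) * int k * ?c i j)
        = (case x of (i, j) \<Rightarrow> int k + of_bool (bl i = bl j \<and> i < j))" if xST: "x \<in> S \<times> T" for x
      proof -
        obtain i j where x: "x = (i, j)" "i \<in> S" "j \<in> T" using xST by auto
        then have "i \<noteq> j" using T by auto
        then show ?thesis
          using x by (cases "bl i" "bl j" rule: linorder_cases; cases i j rule: linorder_cases) (simp_all add: prec_def)
      qed
    qed (use V T in auto)
    also have "\<dots> = (\<Sum>j\<in>T. int (N j))"
    proof -
      have "(\<Sum>i\<in>S. int k + of_bool (bl i = bl j \<and> i < j)) = int (N j)" for j
        unfolding sum.distrib sum_of_bool_card[OF finS] by (simp add: N_def)
      then show ?thesis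
        by (subst sum.cartesian_product[symmetric], subst sum.swap) simp
    qed
    finally show "bounded_below w (\<Sum>j\<in>T. int (N j)) (wt k bl V)"
      using bounded_below_wt[OF w_add, where V = V and bl = bl and k = k] by simp
  qed simp_all
  then have "- (\<Sum>j\<in>T. int (N j)) \<le> w e" if "e \<in> keys half_wt" for e
    using that bounded_belowD by fastforce
  then have big: "- (int h * int (card T)) < w e" if "e \<in> keys half_wt" for e
    using sum_less that by fastforce
  have "lin ?\<theta> half_wt = lin (\<lambda>_. 0) half_wt"
  proof (rule lin_cong)
    fix e assume e: "e \<in> keys half_wt"
    \<comment> \<open>The total degree in \<open>T\<close> exceeds -h times the size of
      \<open>T\<close>, so some single exponent exceeds -h, and there \<open>z\<close> is
      zero.\<close>
    have "\<exists>j\<in>T. - int h < lookup e j"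
    proof (rule ccontr)
      assume "\<not> ?thesis"
      then have "w e \<le> (\<Sum>j\<in>T. - int h)"
        unfolding w_def by (intro sum_mono) auto
      then show False using big[OF e] by (simp add: mult.commute)
    qed
    then have "(\<Prod>j\<in>T. z (lookup e j)) = 0"
      using T(1) z by (intro prod_zero) auto
    then show "?\<theta> e = 0" by (simp add: T_def)
  qed
  then show False using nz by (simp add: lin_def)
qed

end

section \<open>The constant term as a polynomial in t = q^a: special values, degree and
  roots\<close>

context last_variable
begin

text \<open>For \<open>\<tau> i = q\<^sup>a\<close> this is the constant term functional in \<open>z\<^sub>i\<close> after multiplication by
  \<open>(1/z\<^sub>i; q)\<^sub>a\<close>, and \<open>z\<^sub>y\<close> is evaluated at \<open>q\<^sup>-\<^sup>1\<close>.\<close>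

definition qexp :: "(nat \<Rightarrow> qfield) \<Rightarrow> expo \<Rightarrow> qfield" where
  "qexp \<tau> e = q_ind powi (- lookup e y) * (\<Prod>i\<in>V. poly (qcoeff (lookup e i)) (\<tau> i))"

text \<open>With z_y = q^-1 the factor 1 - q^(l+1) z_y/z_i becomes 1 - q^l/z_i, which extends
  (1/z_i; q)_l to (1/z_i; q)_(l+1).\<close>

lemma lin_qexp_rfac:
  assumes i: "i \<in> V" and \<tau>: "\<tau> i = q_ind ^ l"
  shows "lin (qexp \<tau>) (rfac (q_ind ^ Suc l) y i * f) = lin (qexp (\<tau>(i := q_ind ^ Suc l))) f"
proof -
  have iy: "i \<noteq> y" using i V by auto
  have "qexp \<tau> e - q_ind ^ Suc l * qexp \<tau> (e + (single y 1 - single i 1)) = qexp (\<tau>(i := q_ind ^ Suc l)) e" for e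
  proof -
    let ?e = "e + (single y 1 - single i 1)"
    let ?R = "\<Prod>j\<in>V - {i}. poly (qcoeff (lookup e j)) (\<tau> j)"
    let ?u = "q_ind powi (- lookup e y)"
    have L: "lookup ?e x = lookup e x + of_bool (x = y) - of_bool (x = i)" for x
      unfolding lookup_add lookup_ratio by simp
    have 1: "qexp \<tau> e = ?u * (poly (qcoeff (lookup e i)) (\<tau> i) * ?R)"
      unfolding qexp_def using i V by (subst prod.remove[of V i]) auto
    have "(\<Prod>j\<in>V - {i}. poly (qcoeff (lookup ?e j)) (\<tau> j)) = ?R"
      using V by (intro prod.cong refl) (auto simp: L)
    moreover have "q_ind powi (- lookup ?e y) = ?u / q_ind"
      unfolding L using iy by (simp add: power_int_diff)
    ultimately have 2: "qexp \<tau> ?e = (?u / q_ind) * (poly (qcoeff (lookup e i - 1)) (\<tau> i) * ?R)"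
      unfolding qexp_def using i V iy by (subst prod.remove[of V i]) (auto simp: L)
    have "(\<Prod>j\<in>V - {i}. poly (qcoeff (lookup e j)) ((\<tau>(i := q_ind ^ Suc l)) j)) = ?R"
      by (intro prod.cong refl) auto
    then have 3: "qexp (\<tau>(i := q_ind ^ Suc l)) e = ?u * (poly (qcoeff (lookup e i)) (q_ind * \<tau> i) * ?R)"
      unfolding qexp_def using i V by (subst prod.remove[of V i]) (auto simp: \<tau>)
    show ?thesis
      unfolding 1 2 3 qcoeff_shift \<tau> by (simp add: algebra_simps)
  qed
  then show ?thesis
    unfolding lin_rfac lin_functional_scale[symmetric] lin_functional_diff[symmetric] by simp
qed

lemma lin_qexp_qpoch:
  assumes i: "i \<in> V" and \<tau>: "\<tau> i = 1"
  shows "lin (qexp \<tau>) ((\<Prod>l<n. rfac (q_ind ^ Suc l) y i) * f) = lin (qexp (\<tau>(i := q_ind ^ n))) f"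
proof (induction n arbitrary: f)
  case 0
  then show ?case using \<tau> by (simp add: fun_upd_idem)
next
  case (Suc n)
  have "lin (qexp \<tau>) ((\<Prod>l<Suc n. rfac (q_ind ^ Suc l) y i) * f)
      = lin (qexp \<tau>) ((\<Prod>l<n. rfac (q_ind ^ Suc l) y i) * (rfac (q_ind ^ Suc n) y i * f))"
    by (simp only: prod.lessThan_Suc mult.assoc)
  also have "\<dots> = lin (qexp ((\<tau>(i := q_ind ^ n))(i := q_ind ^ Suc n))) f"
    unfolding Suc.IH by (rule lin_qexp_rfac) (simp_all add: i)
  finally show ?case by (simp only: fun_upd_upd)
qed

lemma lin_qexp_qpoch_prod:
  assumes "A \<subseteq> V"
  shows "lin (qexp (\<lambda>_. 1)) ((\<Prod>i\<in>A. \<Prod>l<n. rfac (q_ind ^ Suc l) y i) * f)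
    = lin (qexp (\<lambda>i. if i \<in> A then q_ind ^ n else 1)) f"
proof -
  have "finite A" using assms V(1) by (rule finite_subset)
  then show ?thesis
    using assms
  proof (induction A arbitrary: f)
    case (insert x A)
    have "lin (qexp (\<lambda>_. 1)) ((\<Prod>i\<in>insert x A. \<Prod>l<n. rfac (q_ind ^ Suc l) y i) * f)
        = lin (qexp (\<lambda>_. 1)) ((\<Prod>i\<in>A. \<Prod>l<n. rfac (q_ind ^ Suc l) y i) * ((\<Prod>l<n. rfac (q_ind ^ Suc l) y x) * f))"
      unfolding prod.insert[OF insert.hyps] by (simp only: mult_ac)
    also have "\<dots> = lin (qexp ((\<lambda>i. if i \<in> A then q_ind ^ n else 1)(x := q_ind ^ n))) f"
      using insert.hyps insert.prems by (subst insert.IH, simp, intro lin_qexp_qpoch) auto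
    also have "(\<lambda>i. if i \<in> A then q_ind ^ n else 1)(x := q_ind ^ n) = (\<lambda>i. if i \<in> insert x A then q_ind ^ n else 1)"
      by auto
    finally show ?case .
  qed simp
qed

lemma qexp_one: "qexp (\<lambda>_. 1) e = (if \<forall>i\<in>V. lookup e i = 0 then q_ind powi (- lookup e y) else 0)"
  using V by (auto simp: qexp_def qcoeff_at_1 intro!: prod_zero)

text \<open>In total degree 0, vanishing exponents on \<open>V\<close> force the exponent of
  \<open>y\<close> to vanish too. Evaluating z_y at q^-1 therefore does not affect the constant
  term.\<close>

lemma CT_eq_qexp:
  assumes "\<And>e. e \<in> keys f \<Longrightarrow> (\<Sum>i\<in>insert y V. lookup e i) = 0"
    and "\<And>e x. e \<in> keys f \<Longrightarrow> x \<notin> insert y V \<Longrightarrow> lookup e x = 0"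
  shows "CT f = lin (qexp (\<lambda>_. 1)) f"
  unfolding CT_eq_lin
proof (rule lin_cong)
  fix e assume e: "e \<in> keys f"
  have "e = 0" if "\<forall>i\<in>V. lookup e i = 0"
  proof (rule poly_mapping_eqI)
    fix x
    have "lookup e y = 0" using assms(1)[OF e] that V by simp
    then show "lookup e x = lookup 0 x" using assms(2)[OF e, of x] that by auto
  qed
  then show "(if e = 0 then 1 else 0) = qexp (\<lambda>_. 1) e"
    by (auto simp: qexp_one)
qed

lemma CT_wt_insert: "CT (wt k bl (insert y V)) = lin (qexp (\<lambda>_. q_ind ^ k)) half_wt"
proof -
  have "CT (wt k bl (insert y V)) = lin (qexp (\<lambda>_. 1)) (wt k bl (insert y V))"
    by (rule CT_eq_qexp) (use V wt_total_degree[of "insert y V"] wt_support[of _ k bl "insert y V"] in auto)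
  also have "\<dots> = lin (qexp (\<lambda>i. if i \<in> V then q_ind ^ k else 1)) half_wt"
    unfolding wt_insert_half_wt by (rule lin_qexp_qpoch_prod) simp
  also have "\<dots> = lin (qexp (\<lambda>_. q_ind ^ k)) half_wt"
    by (rule lin_cong) (simp add: qexp_def)
  finally show ?thesis .
qed

text \<open>The term c z_i/z_y makes the degree in \<open>V\<close> positive, so it contributes
  nothing to the constant term in these variables.\<close>

lemma lin_qexp_one_rfac:
  assumes "i \<in> V" "bounded_below (\<lambda>e. \<Sum>i\<in>V. lookup e i) 0 f"
  shows "lin (qexp (\<lambda>_. 1)) (rfac c i y * f) = lin (qexp (\<lambda>_. 1)) f"
proof -
  have "lin (\<lambda>e. qexp (\<lambda>_. 1) (e + (single i 1 - single y 1))) f = lin (\<lambda>_. 0) f"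
  proof (rule lin_cong)
    fix e assume e: "e \<in> keys f"
    let ?e = "e + (single i 1 - single y 1)"
    have L: "lookup ?e x = lookup e x + of_bool (x = i) - of_bool (x = y)" for x
      unfolding lookup_add lookup_ratio by simp
    have "\<not> (\<forall>j\<in>V. lookup ?e j = 0)"
    proof
      assume "\<forall>j\<in>V. lookup ?e j = 0"
      then have "(\<Sum>j\<in>V. lookup ?e j) = 0" by simp
      moreover have "(\<Sum>j\<in>V. lookup ?e j) = (\<Sum>j\<in>V. lookup e j) + (\<Sum>j\<in>V. of_bool (j = i)) - (\<Sum>j\<in>V. of_bool (j = y))"
        unfolding L by (simp only: sum.distrib sum_subtractf)
      moreover have "(\<Sum>j\<in>V. of_bool (j = i)) = (1 :: int)" "(\<Sum>j\<in>V. of_bool (j = y)) = (0 :: int)"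
        using assms(1) V by (auto simp: of_bool_def sum.delta)
      ultimately show False using bounded_belowD[OF assms(2) e] by simp
    qed
    then show "qexp (\<lambda>_. 1) ?e = 0" by (simp only: qexp_one if_False)
  qed
  also have "\<dots> = 0" by (simp add: lin_def)
  finally show ?thesis unfolding lin_rfac by simp
qed

lemma CT_wt: "CT (wt k bl V) = lin (qexp (\<lambda>_. 1)) half_wt"
proof -
  let ?w = "\<lambda>e :: expo. \<Sum>i\<in>V. lookup e i"
  have add: "?w (a + b) = ?w a + ?w b" for a b
    by (simp add: lookup_add sum.distrib)
  \<comment> \<open>The degree bound is carried along because dropping the next factor requires it
    of the remaining product.\<close>
  have drop: "bounded_below ?w 0 ((\<Prod>x\<in>A. rfac (c x) (g x) y) * f)
      \<and> lin (qexp (\<lambda>_. 1)) ((\<Prod>x\<in>A. rfac (c x) (g x) y) * f) = lin (qexp (\<lambda>_. 1)) f"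
    if f: "bounded_below ?w 0 f" and "finite A" "g ` A \<subseteq> V" for f A and c :: "nat \<times> nat \<Rightarrow> qfield" and g
    using that(2,3)
  proof (induction A)
    case (insert x A)
    have x: "g x \<in> V" "g x \<noteq> y" using insert.prems V by auto
    have "bounded_below ?w 0 (rfac (c x) (g x) y)"
      using x V by (intro bounded_below_rfac) (auto simp: sum_subtractf of_bool_def sum.delta)
    then have "bounded_below ?w (0 + 0) (rfac (c x) (g x) y * ((\<Prod>x\<in>A. rfac (c x) (g x) y) * f))"
      using insert by (intro bounded_below_mult[OF add]) auto
    then show ?case
      using insert x lin_qexp_one_rfac[of "g x"] by (simp add: mult.assoc)
  qed (use f in simp)
  have 0: "bounded_below ?w 0 (wt k bl V)"
    using wt_total_degree[of V] V by (auto simp: bounded_below_def)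
  have "CT (wt k bl V) = lin (qexp (\<lambda>_. 1)) (wt k bl V)"
    by (rule CT_eq_qexp) (use V wt_total_degree[of V _ k bl] wt_support[of _ k bl V] in auto)
  also have "\<dots> = lin (qexp (\<lambda>_. 1)) half_wt"
  proof -
    let ?A = "SIGMA i:V. {..<k + of_bool (bl i = bl y)}"
    have "half_wt = (\<Prod>x\<in>?A. rfac (q_ind ^ snd x) (fst x) y) * wt k bl V"
      unfolding half_wt_def using V by (subst prod.Sigma) (auto simp: case_prod_unfold)
    moreover have "finite ?A" "fst ` ?A \<subseteq> V" using V by auto
    ultimately show ?thesis
      using drop[OF 0, of ?A fst "\<lambda>x. q_ind ^ snd x"] by simp
  qed
  finally show ?thesis .
qed

text \<open>Its value at q^k is the constant term with \<open>y\<close>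
  (\<open>CT_wt_insert\<close>), its value at 1 the one without (\<open>CT_wt\<close>).\<close>

definition last_poly :: "qfield poly" where
  "last_poly = (\<Sum>e\<in>keys half_wt. smult (lookup half_wt e * q_ind powi (- lookup e y)) (\<Prod>i\<in>V. qcoeff (lookup e i)))"

lemma poly_last_poly: "poly last_poly t = lin (qexp (\<lambda>_. t)) half_wt"
  by (simp add: last_poly_def poly_sum poly_prod lin_def qexp_def mult.assoc)

abbreviation last_deg :: nat where
  "last_deg \<equiv> k * card V + card {j \<in> V. bl j = bl y}"

text \<open>A monomial contributes degree at most its total exponent on \<open>V\<close>, or nothing
  if an exponent is negative. Only the factors 1 - q^l z_i/z_y raise this total, each by at most
  one, and there are \<open>last_deg\<close> of them.\<close>

lemma degree_last_poly: "degree last_poly \<le> last_deg"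
  unfolding last_poly_def
proof (rule degree_sum_le)
  fix e assume e: "e \<in> keys half_wt"
  let ?w = "\<lambda>e :: expo. - (\<Sum>i\<in>V. lookup e i)"
  have add: "?w (a + b) = ?w a + ?w b" for a b
    by (simp add: lookup_add sum.distrib)
  have "bounded_below ?w ((\<Sum>i\<in>V. \<Sum>l<k + of_bool (bl i = bl y). 1) + 0) half_wt"
    unfolding half_wt_def
  proof (intro bounded_below_mult[OF add] bounded_below_prod[OF add] bounded_below_rfac)
    show "- 1 \<le> ?w (single i 1 - single y 1)" if "i \<in> V" for i
      using that V by (simp add: sum_subtractf of_bool_def sum.delta)
    show "bounded_below ?w 0 (wt k bl V)"
      using wt_total_degree[of V] V by (auto simp: bounded_below_def)
  qed simp_all
  moreover have "(\<Sum>i\<in>V. \<Sum>l<k + of_bool (bl i = bl y). 1) = int last_deg"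
    using V sum_of_bool_card[of V "\<lambda>i. bl i = bl y"] by (simp add: sum.distrib mult.commute)
  ultimately have *: "(\<Sum>i\<in>V. lookup e i) \<le> int last_deg"
    using e bounded_belowD by fastforce
  have "degree (\<Prod>i\<in>V. qcoeff (lookup e i)) \<le> last_deg"
  proof (cases "\<exists>i\<in>V. lookup e i < 0")
    case True
    then have "(\<Prod>i\<in>V. qcoeff (lookup e i)) = 0" using V qcoeff_neg by (intro prod_zero) blast+
    then show ?thesis by simp
  next
    case False
    have "int (degree (\<Prod>i\<in>V. qcoeff (lookup e i))) \<le> int (\<Sum>i\<in>V. degree (qcoeff (lookup e i)))"
      using degree_prod_sum_le[OF V(1), of "\<lambda>i. qcoeff (lookup e i)"] unfolding o_def of_nat_le_iff .
    also have "\<dots> \<le> (\<Sum>i\<in>V. lookup e i)"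
      unfolding of_nat_sum
    proof (rule sum_mono)
      fix i assume "i \<in> V"
      then show "int (degree (qcoeff (lookup e i))) \<le> lookup e i"
        using degree_qcoeff[of "lookup e i"] False by fastforce
    qed
    finally show ?thesis using * by linarith
  qed
  then show "degree (smult (lookup half_wt e * q_ind powi (- lookup e y)) (\<Prod>i\<in>V. qcoeff (lookup e i))) \<le> last_deg"
    using degree_smult_le order.trans by blast
qed simp

lemma last_poly_root:
  assumes h: "1 \<le> h" "h \<le> last_deg"
  shows "poly last_poly (q_ind powi (- int h)) = 0"
proof -
  obtain w where w: "\<And>e. - int h < e \<Longrightarrow>
      poly (qcoeff e) (q_ind powi (- int h)) = (\<Sum>m\<in>{1..h}. w m * q_ind powi (- (int m * e)))"
    using qcoeff_at_negative_power[OF h(1)] by blast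
  \<comment> \<open>Each coefficient is split into its grid evaluation \<open>g\<close> and an error
    \<open>z\<close> supported on exponents at most -h. Expanding the product over \<open>V\<close>
    chooses the set \<open>S\<close> of evaluated variables and their grid points
    \<open>m\<close>.\<close>
  define g where "g e = (\<Sum>m\<in>{1..h}. w m * q_ind powi (- (int m * e)))" for e
  define z where "z e = poly (qcoeff e) (q_ind powi (- int h)) - g e" for e
  have z: "z e = 0" if "- int h < e" for e
    using w[OF that] by (simp add: z_def g_def)
  \<comment> \<open>The update at \<open>y\<close> records that z_y is evaluated at q^-1; the
    extensional function \<open>m\<close> carries no usable value there.\<close>
  define \<theta> where "\<theta> S m e = q_ind powi (- (\<Sum>i\<in>insert y S. int ((m(y := 1)) i) * lookup e i))
      * (\<Prod>j\<in>V - S. z (lookup e j))" for S :: "nat set" and m :: "nat \<Rightarrow> nat" and e :: expo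
  have "qexp (\<lambda>_. q_ind powi (- int h)) e
      = (\<Sum>S\<in>Pow V. \<Sum>m\<in>PiE S (\<lambda>_. {1..h}). (\<Prod>i\<in>S. w (m i)) * \<theta> S m e)" for e
  proof -
    have "qexp (\<lambda>_. q_ind powi (- int h)) e = q_ind powi (- lookup e y) * (\<Prod>i\<in>V. g (lookup e i) + z (lookup e i))"
      by (simp add: qexp_def z_def)
    also have "\<dots> = (\<Sum>S\<in>Pow V. q_ind powi (- lookup e y) * ((\<Prod>i\<in>S. g (lookup e i)) * (\<Prod>j\<in>V - S. z (lookup e j))))"
      unfolding prod_add[OF V(1)] sum_distrib_left ..
    also have "\<dots> = (\<Sum>S\<in>Pow V. \<Sum>m\<in>PiE S (\<lambda>_. {1..h}). (\<Prod>i\<in>S. w (m i)) * \<theta> S m e)"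
    proof (rule sum.cong[OF refl])
      fix S assume "S \<in> Pow V"
      then have S: "finite S" "y \<notin> S" using V by (auto intro: finite_subset)
      have "(\<Prod>i\<in>S. g (lookup e i)) = (\<Sum>m\<in>PiE S (\<lambda>_. {1..h}). \<Prod>i\<in>S. w (m i) * q_ind powi (- (int (m i) * lookup e i)))"
        unfolding g_def using S by (subst prod_sum_PiE) auto
      moreover have "q_ind powi (- lookup e y) * ((\<Prod>i\<in>S. w (m i) * q_ind powi (- (int (m i) * lookup e i)))
          * (\<Prod>j\<in>V - S. z (lookup e j))) = (\<Prod>i\<in>S. w (m i)) * \<theta> S m e" for m
      proof -
        have pw: "(\<Prod>i\<in>S. q_ind powi (f i)) = q_ind powi (\<Sum>i\<in>S. f i)" for f :: "nat \<Rightarrow> int"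
          using S(1) by induction (simp_all add: power_int_add)
        have "(\<Sum>i\<in>insert y S. int ((m(y := 1)) i) * lookup e i) = lookup e y + (\<Sum>i\<in>S. int (m i) * lookup e i)"
          using S by (subst sum.insert) (auto intro!: sum.cong)
        then have "- (\<Sum>i\<in>insert y S. int ((m(y := 1)) i) * lookup e i)
            = - lookup e y + (\<Sum>i\<in>S. - (int (m i) * lookup e i))"
          by (simp add: sum_negf)
        then have "\<theta> S m e = q_ind powi (- lookup e y) * (\<Prod>i\<in>S. q_ind powi (- (int (m i) * lookup e i)))
            * (\<Prod>j\<in>V - S. z (lookup e j))"
          unfolding \<theta>_def pw by (subst power_int_add[symmetric]) simp_all
        then show ?thesis
          unfolding prod.distrib by (simp only: mult_ac)
      qed
      ultimately show "q_ind powi (- lookup e y) * ((\<Prod>i\<in>S. g (lookup e i)) * (\<Prod>j\<in>V - S. z (lookup e j)))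
          = (\<Sum>m\<in>PiE S (\<lambda>_. {1..h}). (\<Prod>i\<in>S. w (m i)) * \<theta> S m e)"
        by (simp only: sum_distrib_left sum_distrib_right)
    qed
    finally show ?thesis .
  qed
  then have "poly last_poly (q_ind powi (- int h))
      = lin (\<lambda>e. \<Sum>S\<in>Pow V. \<Sum>m\<in>PiE S (\<lambda>_. {1..h}). (\<Prod>i\<in>S. w (m i)) * \<theta> S m e) half_wt"
    unfolding poly_last_poly by (intro lin_cong) simp
  also have "\<dots> = (\<Sum>S\<in>Pow V. \<Sum>m\<in>PiE S (\<lambda>_. {1..h}). (\<Prod>i\<in>S. w (m i)) * lin (\<theta> S m) half_wt)"
    by (simp only: lin_functional_sum lin_functional_scale)
  also have "\<dots> = 0"
  proof (intro sum.neutral ballI)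
    fix S m assume S: "S \<in> Pow V" and m: "m \<in> PiE S (\<lambda>_. {1..h})"
    have "lin (\<theta> S m) half_wt = 0"
      unfolding \<theta>_def
    proof (rule grid_term_vanishes[OF h])
      show "(m(y := 1)) i \<in> {1..h}" if "i \<in> S" for i
        using m that h by (auto simp: PiE_iff)
    qed (use S z in auto)
    then show "(\<Prod>i\<in>S. w (m i)) * lin (\<theta> S m) half_wt = 0" by simp
  qed
  finally show ?thesis .
qed

text \<open>\<open>last_poly\<close> and a multiple of \<open>B\<close> both have degree at most
  \<open>last_deg\<close> and agree at the \<open>last_deg + 1\<close> points 1, q^-1, ...,
  q^-last_deg, hence everywhere. The claim compares their values at q^k and at 1.\<close>

theorem CT_wt_add_variable:
  "CT (wt k bl (insert y V)) = CT (wt k bl V) * ((\<Prod>h=1..last_deg. 1 - q_ind ^ (k + h)) / (\<Prod>h=1..last_deg. 1 - q_ind ^ h))"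
proof -
  define B where "B = (\<Prod>h=1..last_deg. [:1, - (q_ind ^ h):])"
  have B: "poly B t = (\<Prod>h=1..last_deg. 1 - t * q_ind ^ h)" for t
    by (simp add: B_def poly_prod)
  have "(\<Prod>h=1..last_deg. 1 - q_ind ^ h) \<noteq> 0" by auto
  then have B1: "poly B 1 \<noteq> 0" by (simp add: B)
  have degB: "degree B \<le> last_deg"
    unfolding B_def by (rule order.trans[OF degree_prod_sum_le]) (simp_all add: o_def)
  let ?A = "(\<lambda>h. q_ind powi (- int h)) ` {0..last_deg}"
  have "inj_on (\<lambda>h. q_ind powi (- int h)) {0..last_deg}"
    by (auto simp: inj_on_def)
  then have cardA: "card ?A = Suc last_deg"
    by (simp add: card_image)
  have "last_poly = smult (poly last_poly 1 / poly B 1) B"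
  proof (rule poly_eqI_degree[of ?A])
    fix x assume "x \<in> ?A"
    then obtain h where h: "h \<le> last_deg" "x = q_ind powi (- int h)" by auto
    show "poly last_poly x = poly (smult (poly last_poly 1 / poly B 1) B) x"
    proof (cases "h = 0")
      case True
      then show ?thesis using h B1 by simp
    next
      case False
      then have "poly B x = 0"
        unfolding B using h by (intro prod_zero) (auto intro!: bexI[of _ h] simp: power_int_minus)
      then show ?thesis using last_poly_root[of h] h False by simp
    qed
  next
    show "degree last_poly < card ?A" using degree_last_poly cardA by simp
    have "degree (smult (poly last_poly 1 / poly B 1) B) \<le> last_deg"
      using degree_smult_le[of _ B] degB order.trans by blast
    then show "degree (smult (poly last_poly 1 / poly B 1) B) < card ?A" using cardA by simp
  qed
  then have "poly last_poly (q_ind ^ k) = poly last_poly 1 / poly B 1 * poly B (q_ind ^ k)"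
    by (metis poly_smult)
  then show ?thesis
    unfolding CT_wt_insert CT_wt poly_last_poly B by (simp add: power_add)
qed

end

section \<open>Rotating the blocks\<close>

lemma (in monomial_hom) msub_rfac:
  assumes "\<phi> (single i 1 - single j 1) = single i' 1 - single j' 1"
  shows "msub \<kappa> \<phi> (rfac c i j) = rfac (c * \<kappa> (single i 1 - single j 1)) i' j'"
  by (simp add: rfac_def msub_diff assms)

text \<open>Replacing z_i by q z_i in the blocks with label at most \<open>b\<close> exchanges the
  roles of i and j in (z_i/z_j; q)_k (q z_j/z_i; q)_k across the cut and changes nothing on either
  side of it. Adding \<open>C\<close>, which exceeds every label, puts the moved blocks
  last.\<close>

lemma CT_wt_rotate:
  assumes V: "finite V" "\<And>i. i \<in> V \<Longrightarrow> bl i < C"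
  shows "CT (wt k (\<lambda>i. if bl i \<le> b then bl i + C else bl i) V) = CT (wt k bl V)"
proof -
  define bl' where "bl' = (\<lambda>i. if bl i \<le> b then bl i + C else bl i)"
  let ?low = "\<lambda>i. bl i \<le> b"
  define \<kappa> where "\<kappa> e = q_ind powi (\<Sum>i | i \<in> V \<and> ?low i. lookup e i)" for e :: expo
  interpret monomial_hom \<kappa> id
    by unfold_locales (simp_all add: \<kappa>_def lookup_add sum.distrib power_int_add)
  have \<kappa>: "\<kappa> (single i 1 - single j 1) = q_ind powi (of_bool (?low i) - of_bool (?low j))"
    if "i \<in> V" "j \<in> V" for i j
    using that V(1) by (simp add: \<kappa>_def sum_subtractf of_bool_def sum.delta)
  have rf: "msub \<kappa> id (rfac c i j) = rfac (c * q_ind powi (of_bool (?low i) - of_bool (?low j))) i j"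
    if "i \<in> V" "j \<in> V" for c i j
    using that \<kappa> by (subst msub_rfac) auto
  have same: "msub \<kappa> id (pfac i j u v) = pfac i j u v" if "i \<in> V" "j \<in> V" "?low i = ?low j" for i j u v
    using that by (simp add: pfac_def msub_mult msub_prod rf)
  have cross: "msub \<kappa> id (pfac i j u u) = pfac j i u u" if "i \<in> V" "j \<in> V" "?low i" "\<not> ?low j" for i j u
  proof -
    have 1: "q_ind ^ l * q_ind powi (of_bool (?low i) - of_bool (?low j)) = q_ind ^ Suc l" for l
      using that by simp
    have 2: "q_ind ^ Suc l * q_ind powi (of_bool (?low j) - of_bool (?low i)) = q_ind ^ l" for l
      using that by (simp add: power_int_minus)
    show ?thesis
      unfolding pfac_def msub_mult msub_prod rf[OF that(1,2)] rf[OF that(2,1)] 1 2 by (rule mult.commute)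
  qed
  have "msub \<kappa> id (wt k bl V)
      = (\<Prod>(i, j)\<in>{(i, j) \<in> V \<times> V. prec bl i j}. msub \<kappa> id (pfac i j (k + of_bool (bl i = bl j)) k))"
    unfolding wt_def msub_prod by (simp add: case_prod_unfold)
  also have "\<dots> = wt k bl' V"
    unfolding wt_def
  proof (rule prod.reindex_bij_witness[of _
        "\<lambda>(i, j). if \<not> ?low i \<and> ?low j then (j, i) else (i, j)"
        "\<lambda>(i, j). if ?low i \<and> \<not> ?low j then (j, i) else (i, j)"])
    fix x assume "x \<in> {(i, j) \<in> V \<times> V. prec bl i j}"
    then obtain i j where x: "x = (i, j)" "i \<in> V" "j \<in> V" "prec bl i j" by auto
    show "(case case x of (i, j) \<Rightarrow> if ?low i \<and> \<not> ?low j then (j, i) else (i, j) of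
          (i, j) \<Rightarrow> pfac i j (k + of_bool (bl' i = bl' j)) k)
        = (case x of (i, j) \<Rightarrow> msub \<kappa> id (pfac i j (k + of_bool (bl i = bl j)) k))"
    proof (cases "?low i = ?low j")
      case True
      then show ?thesis using x by (simp add: same bl'_def)
    next
      case False
      then have "?low i" "\<not> ?low j" using x(4) by (auto simp: prec_def)
      then show ?thesis using x cross[of i j k] V(2)[of j] by (auto simp: bl'_def)
    qed
    show "(case x of (i, j) \<Rightarrow> if ?low i \<and> \<not> ?low j then (j, i) else (i, j)) \<in> {(i, j) \<in> V \<times> V. prec bl' i j}"
      using x V(2)[of i] V(2)[of j] by (auto simp: prec_def bl'_def)
  next
    fix x assume "x \<in> {(i, j) \<in> V \<times> V. prec bl' i j}"
    then obtain i j where x: "x = (i, j)" "i \<in> V" "j \<in> V" "prec bl' i j" by auto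
    show "(case x of (i, j) \<Rightarrow> if \<not> ?low i \<and> ?low j then (j, i) else (i, j)) \<in> {(i, j) \<in> V \<times> V. prec bl i j}"
      using x V(2)[of i] V(2)[of j] by (auto simp: prec_def bl'_def split: if_splits)
    show "(case case x of (i, j) \<Rightarrow> if \<not> ?low i \<and> ?low j then (j, i) else (i, j) of
          (i, j) \<Rightarrow> if ?low i \<and> \<not> ?low j then (j, i) else (i, j)) = x"
      using x V(2)[of i] V(2)[of j] by (auto simp: prec_def bl'_def split: if_splits)
  qed (auto simp: prec_def)
  finally show ?thesis unfolding bl'_def[symmetric] using CT_msub[of "wt k bl V"] by simp
qed

section \<open>The constant term of the weight function\<close>

lemma qfact_q_ind: "qfact q_ind m = (\<Prod>i=1..m. 1 - q_ind ^ i) / (1 - q_ind) ^ m"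
  by (simp add: qfact_def qnum_def prod_dividef)

lemma q_ind_neq_1 [simp]: "q_ind \<noteq> 1"
  using q_ind_power_eq_1_iff[of 1] by simp

lemma qfact_q_ind_nonzero [simp]: "qfact q_ind m \<noteq> 0"
  by (auto simp: qfact_q_ind)

lemma qnum_q_ind_eq_0_iff [simp]: "qnum q_ind m = 0 \<longleftrightarrow> m = 0"
  by (auto simp: qnum_def)

lemma qfact_add:
  "qfact q_ind (k + m) / qfact q_ind k
    = qfact q_ind m * ((\<Prod>h=1..m. 1 - q_ind ^ (k + h)) / (\<Prod>h=1..m. 1 - q_ind ^ h))"
proof -
  let ?f = "\<lambda>a. \<Prod>i=1..a. 1 - q_ind ^ i"
  have nz: "?f a \<noteq> 0" for a by auto
  have "?f (k + m) = ?f k * (\<Prod>h=1..m. 1 - q_ind ^ (k + h))"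
    by (induction m) simp_all
  then show ?thesis
    using nz[of m] nz[of k] by (simp add: qfact_q_ind power_add field_simps)
qed

section \<open>The product formula for arbitrary block labels\<close>

definition rank :: "(nat \<Rightarrow> nat) \<Rightarrow> nat set \<Rightarrow> nat \<Rightarrow> nat" where
  "rank bl V v = card {u \<in> V. bl u = bl v \<and> u < v}"

text \<open>The number of variables left after cutting every block down to its first
  \<open>i\<close> elements; this is n - m(i) in the theorem.\<close>

definition layers :: "(nat \<Rightarrow> nat) \<Rightarrow> nat set \<Rightarrow> nat \<Rightarrow> nat" where
  "layers bl V i = card {v \<in> V. rank bl V v < i}"

text \<open>\<open>L\<close> may be any positive upper bound for the block sizes. The induction
  needs the size of a largest block, the theorem needs \<open>M + 1\<close>.\<close>

definition closed_form :: "nat \<Rightarrow> (nat \<Rightarrow> nat) \<Rightarrow> nat set \<Rightarrow> nat \<Rightarrow> qfield" where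
  "closed_form k bl V L = qfact q_ind (k * card V + L - 1) / qfact q_ind k ^ card V
    / (\<Prod>i\<in>{1..<L}. qnum q_ind (k * layers bl V i + i))"

text \<open>Beyond the largest block size a layer is all of \<open>V\<close>, so raising
  \<open>L\<close> by one multiplies numerator and denominator by the same
  \<open>qnum\<close>.\<close>

lemma closed_form_eq:
  assumes "1 \<le> M" "M \<le> L" "\<And>v. v \<in> V \<Longrightarrow> rank bl V v < M"
  shows "closed_form k bl V L = closed_form k bl V M"
  using assms(2)
proof (induction L rule: dec_induct)
  case (step L)
  have "{v \<in> V. rank bl V v < L} = V" using assms(3) step.hyps by force
  then have l: "layers bl V L = card V" by (simp add: layers_def)
  have L: "{1..<Suc L} = insert L {1..<L}" "k * card V + Suc L - 1 = Suc (k * card V + L - 1)"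
    "Suc (k * card V + L - 1) = k * card V + L"
    using assms(1) step.hyps by auto
  have q: "qfact q_ind (Suc m) = qfact q_ind m * qnum q_ind (Suc m)" for m
    by (simp add: qfact_def)
  have "qnum q_ind (k * card V + L) \<noteq> 0" using assms(1) step.hyps by simp
  then have "closed_form k bl V (Suc L) = closed_form k bl V L"
    unfolding closed_form_def L(1,2) q by (simp add: L(3) l)
  then show ?case using step.IH by simp
qed simp

lemma rank_mono: "finite V \<Longrightarrow> bl u = bl v \<Longrightarrow> u < v \<Longrightarrow> u \<in> V \<Longrightarrow> rank bl V u < rank bl V v"
  unfolding rank_def by (intro psubset_card_mono) auto

text \<open>Induction on the number of variables: rotate a largest block to the end and remove its
  last variable \<open>y\<close>. The layers that enter the denominator do not change, and the new
  quotient turns the factorial of \<open>last_deg\<close> into that of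
  \<open>k + last_deg\<close>.\<close>

theorem CT_wt_closed_form:
  assumes k: "1 \<le> k" and "finite V" "1 \<le> L" "\<And>v. v \<in> V \<Longrightarrow> rank bl V v < L"
  shows "CT (wt k bl V) = closed_form k bl V L"
  using assms(2-4)
proof (induction "card V" arbitrary: V bl L)
  case 0
  have "qfact q_ind (L - 1) = (\<Prod>i\<in>{1..<L}. qnum q_ind i)"
    unfolding qfact_def using 0 by (intro prod.cong) auto
  moreover have "(\<Prod>i\<in>{1..<L}. qnum q_ind i) \<noteq> 0" by auto
  ultimately show ?case using 0 by (simp add: wt_def CT_def closed_form_def layers_def)
next
  case (Suc n)
  note V = \<open>finite V\<close>
  have "V \<noteq> {}" using Suc.hyps(2) by auto
  then have "Max (rank bl V ` V) \<in> rank bl V ` V" using V by simp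
  then obtain y where y: "y \<in> V" "rank bl V y = Max (rank bl V ` V)" by auto
  have max: "rank bl V v \<le> rank bl V y" if "v \<in> V" for v
    using that V y(2) by simp
  have top: "v \<le> y" if "v \<in> V" "bl v = bl y" for v
    using rank_mono[OF V, of bl y v] max[OF that(1)] that y(1) by (metis leI not_le)
  define V' where "V' = V - {y}"
  have V': "finite V'" "y \<notin> V'" "insert y V' = V" "n = card V'" "card V = Suc (card V')"
    using V y(1) Suc.hyps(2) by (auto simp: V'_def)
  define C where "C = Suc (Max (bl ` V))"
  \<comment> \<open>The label of \<open>y\<close> is the largest among those moved up by
    \<open>C\<close>, so its block comes last.\<close>
  define bl' where "bl' = (\<lambda>i. if bl i \<le> bl y then bl i + C else bl i)"
  have C: "bl i < C" if "i \<in> V" for i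
    using that V by (simp add: C_def less_Suc_eq_le)
  have same: "bl' i = bl' j \<longleftrightarrow> bl i = bl j" if "i \<in> V" "j \<in> V" for i j
    using C[OF that(1)] C[OF that(2)] by (auto simp: bl'_def)
  let ?r = "rank bl V y"
  have rank': "rank bl' V' v = rank bl V v" if "v \<in> V'" for v
  proof -
    have "{u \<in> V'. bl' u = bl' v \<and> u < v} = {u \<in> V. bl u = bl v \<and> u < v}"
      using that top[of v] by (auto simp: V'_def same)
    then show ?thesis by (simp add: rank_def)
  qed
  have block: "{j \<in> V'. bl' j = bl' y} = {u \<in> V. bl u = bl y \<and> u < y}"
    using top y(1) by (auto simp: V'_def same order.strict_iff_order)
  interpret last_variable k y V' bl'
  proof
    show "prec bl' i y" if "i \<in> V'" for i
    proof (cases "bl i = bl y")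
      case True
      then show ?thesis using that top[of i] by (auto simp: prec_def V'_def bl'_def)
    next
      case False
      then show ?thesis using that C[of i] by (auto simp: prec_def V'_def bl'_def)
    qed
    show "card {j \<in> V'. bl' j = bl' i} \<le> Suc (card {j \<in> V'. bl' j = bl' y})" if i: "i \<in> V'" for i
    proof -
      let ?B = "{j \<in> V'. bl' j = bl' i}"
      \<comment> \<open>The rank of the last element bounds the number of elements before it, so
        maximality of the rank of \<open>y\<close> bounds all block sizes.\<close>
      define u where "u = Max ?B"
      have B: "finite ?B" "i \<in> ?B" using V' i by auto
      then have "u \<in> ?B" unfolding u_def by (intro Max_in) auto
      have "?B \<subseteq> insert u {j \<in> V. bl j = bl u \<and> j < u}"
      proof
        fix j assume j: "j \<in> ?B"
        then have "j \<le> u" unfolding u_def using B by simp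
        then show "j \<in> insert u {j \<in> V. bl j = bl u \<and> j < u}"
          using j \<open>u \<in> ?B\<close> same[of j u] by (auto simp: V'_def)
      qed
      then have "card ?B \<le> card (insert u {j \<in> V. bl j = bl u \<and> j < u})"
        using V by (intro card_mono) auto
      also have "\<dots> \<le> Suc (rank bl V u)"
        unfolding rank_def using V by (simp add: card_insert_if)
      also have "rank bl V u \<le> ?r" using max \<open>u \<in> ?B\<close> by (auto simp: V'_def)
      finally show ?thesis unfolding block by (simp add: rank_def)
    qed
  qed (use k V' in auto)
  \<comment> \<open>The removed \<open>y\<close> has rank \<open>?r\<close> and is not counted in
    these layers.\<close>
  have layers: "layers bl' V' i = layers bl V i" if "i \<le> ?r" for i
  proof -
    have "v \<in> V' \<and> rank bl' V' v < i \<longleftrightarrow> v \<in> V \<and> rank bl V v < i" for v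
      using that rank'[of v] by (cases "v = y") (auto simp: V'_def)
    then show ?thesis by (simp add: layers_def)
  qed
  have deg: "last_deg = k * card V' + ?r"
    unfolding block by (simp add: rank_def)
  have "CT (wt k bl V) = CT (wt k bl' (insert y V'))"
    unfolding bl'_def V'(3) using CT_wt_rotate[where b = "bl y" and k = k, OF Suc.prems(1) C] by simp
  also have "\<dots> = CT (wt k bl' V') * ((\<Prod>h=1..last_deg. 1 - q_ind ^ (k + h)) / (\<Prod>h=1..last_deg. 1 - q_ind ^ h))"
    by (rule CT_wt_add_variable)
  also have "CT (wt k bl' V') = closed_form k bl' V' (Suc ?r)"
  proof (rule Suc.hyps(1)[OF V'(4) V'(1)])
    show "rank bl' V' v < Suc ?r" if "v \<in> V'" for v
      using max[of v] that rank'[of v] by (auto simp: V'_def)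
  qed simp
  also have "closed_form k bl' V' (Suc ?r)
      = qfact q_ind last_deg / qfact q_ind k ^ card V' / (\<Prod>i\<in>{1..<Suc ?r}. qnum q_ind (k * layers bl V i + i))"
    unfolding closed_form_def deg using layers by simp
  also have "\<dots> * ((\<Prod>h=1..last_deg. 1 - q_ind ^ (k + h)) / (\<Prod>h=1..last_deg. 1 - q_ind ^ h))
      = qfact q_ind (k + last_deg) / qfact q_ind k / qfact q_ind k ^ card V'
        / (\<Prod>i\<in>{1..<Suc ?r}. qnum q_ind (k * layers bl V i + i))"
    unfolding qfact_add by simp
  also have "\<dots> = closed_form k bl V (Suc ?r)"
    unfolding closed_form_def deg V'(5) by (simp add: algebra_simps)
  also have "\<dots> = closed_form k bl V L"
    by (rule closed_form_eq[symmetric]) (use max Suc.prems(3) y(1) in \<open>auto simp: less_Suc_eq_le Suc_le_eq\<close>)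
  finally show ?case .
qed

section \<open>Antisymmetrisation inside the blocks\<close>

definition swap_idx :: "nat \<Rightarrow> nat \<Rightarrow> nat \<Rightarrow> nat" where
  "swap_idx a b x = (if x = a then b else if x = b then a else x)"

lemma swap_idx_swap_idx [simp]: "swap_idx a b (swap_idx a b x) = x"
  by (simp add: swap_idx_def)

lemma inj_swap_idx [simp]: "inj (swap_idx a b)"
  by (metis injI swap_idx_swap_idx)

lemma swap_idx_other [simp]: "x \<noteq> a \<Longrightarrow> x \<noteq> b \<Longrightarrow> swap_idx a b x = x"
  by (simp add: swap_idx_def)

lemma swap_idx_left [simp]: "swap_idx a b a = b" and swap_idx_right [simp]: "swap_idx a b b = a"
  by (simp_all add: swap_idx_def)

lemma swap_idx_in_iff: "a \<in> I \<Longrightarrow> b \<in> I \<Longrightarrow> swap_idx a b x \<in> I \<longleftrightarrow> x \<in> I"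
  by (auto simp: swap_idx_def)

text \<open>\<open>map_key\<close> precomposes the exponent function with the index map. A
  transposition is its own inverse, so this is the substitution itself.\<close>

definition swap_vars :: "nat \<Rightarrow> nat \<Rightarrow> laurent \<Rightarrow> laurent" where
  "swap_vars a b = msub (\<lambda>_. 1) (Poly_Mapping.map_key (swap_idx a b))"

lemma lookup_map_key_swap_idx: "lookup (Poly_Mapping.map_key (swap_idx a b) e) x = lookup e (swap_idx a b x)"
  by (simp add: map_key.rep_eq)

interpretation swap_vars: monomial_hom "\<lambda>_. 1" "Poly_Mapping.map_key (swap_idx a b)"
  for a b
proof
  show "Poly_Mapping.map_key (swap_idx a b) e = 0 \<longleftrightarrow> e = (0 :: expo)" for e
  proof
    assume *: "Poly_Mapping.map_key (swap_idx a b) e = 0"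
    show "e = 0"
    proof (rule poly_mapping_eqI)
      fix x
      show "lookup e x = lookup 0 x"
        using lookup_map_key_swap_idx[of a b e "swap_idx a b x"] * by simp
    qed
  qed (simp add: poly_mapping_eq_iff fun_eq_iff lookup_map_key_swap_idx)
qed (simp_all add: poly_mapping_eq_iff fun_eq_iff lookup_map_key_swap_idx lookup_add)

lemma map_key_swap_idx_single: "Poly_Mapping.map_key (swap_idx a b) (single i c) = single (swap_idx a b i) c"
  using map_key_single[OF inj_swap_idx, of a b "swap_idx a b i" c] by simp

lemma swap_vars_mult: "swap_vars a b (f * g) = swap_vars a b f * swap_vars a b g"
  by (simp add: swap_vars_def swap_vars.msub_mult)

lemma swap_vars_one [simp]: "swap_vars a b 1 = 1"
  by (simp add: swap_vars_def)

lemma swap_vars_prod: "swap_vars a b (\<Prod>x\<in>A. f x) = (\<Prod>x\<in>A. swap_vars a b (f x))"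
  by (simp add: swap_vars_def swap_vars.msub_prod)

lemma swap_vars_diff: "swap_vars a b (f - g) = swap_vars a b f - swap_vars a b g"
  by (simp add: swap_vars_def msub_diff)

lemma swap_vars_power: "swap_vars a b (f ^ n) = swap_vars a b f ^ n"
  by (induction n) (simp_all add: swap_vars_mult)

lemma swap_vars_lconst [simp]: "swap_vars a b (lconst c) = lconst c"
  by (simp add: swap_vars_def lconst_def)

lemma swap_vars_zvar [simp]: "swap_vars a b (zvar i) = zvar (swap_idx a b i)"
  by (simp add: swap_vars_def zvar_def zpow_def map_key_swap_idx_single)

lemma swap_vars_zinv [simp]: "swap_vars a b (zinv i) = zinv (swap_idx a b i)"
  by (simp add: swap_vars_def zinv_def zpow_def map_key_swap_idx_single)

lemma CT_swap_vars: "CT (swap_vars a b f) = CT f"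
  by (simp add: swap_vars_def swap_vars.CT_msub)

lemma swap_vars_add: "swap_vars a b (f + g) = swap_vars a b f + swap_vars a b g"
  by (simp add: swap_vars_def msub_add)

lemma swap_vars_single [simp]:
  "swap_vars a b (single e c) = single (Poly_Mapping.map_key (swap_idx a b) e) c"
  by (simp add: swap_vars_def)

lemma swap_vars_0 [simp]: "swap_vars a b 0 = 0"
  by (simp add: swap_vars_def)

text \<open>Reduces arbitrary transpositions to adjacent ones.\<close>

lemma swap_vars_conjugate:
  assumes "a < b"
  shows "swap_vars a (Suc b) f = swap_vars b (Suc b) (swap_vars a b (swap_vars b (Suc b) f))"
proof -
  have "Poly_Mapping.map_key (swap_idx a (Suc b)) e
      = Poly_Mapping.map_key (swap_idx b (Suc b)) (Poly_Mapping.map_key (swap_idx a b) (Poly_Mapping.map_key (swap_idx b (Suc b)) e))"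
    for e :: expo
    using assms by (auto simp: poly_mapping_eq_iff fun_eq_iff lookup_map_key_swap_idx swap_idx_def)
  then show ?thesis
    by (induction f rule: laurent_induct) (simp_all add: swap_vars_add)
qed

lemma swap_vars_monomial:
  assumes "a \<in> I" "b \<in> I"
  shows "swap_vars a b (\<Prod>i\<in>I. zvar i ^ f i) = (\<Prod>i\<in>I. zvar i ^ f (swap_idx a b i))"
  unfolding swap_vars_prod swap_vars_power swap_vars_zvar
  by (rule prod.reindex_bij_witness[of _ "swap_idx a b" "swap_idx a b"]) (use assms in \<open>auto simp: swap_idx_in_iff\<close>)

text \<open>Models f \<mapsto> CT(f g) with g antisymmetric in the variables of one block. Only
  adjacent transpositions are assumed, since for these the antisymmetry is easy to check.\<close>

locale alternating =
  fixes \<Lambda> :: "laurent \<Rightarrow> qfield" and lo M :: nat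
  assumes add: "\<Lambda> (f + g) = \<Lambda> f + \<Lambda> g"
    and scale: "\<Lambda> (lconst c * f) = c * \<Lambda> f"
    and adjacent: "lo < a \<Longrightarrow> a < M \<Longrightarrow> \<Lambda> (swap_vars a (Suc a) f) = - \<Lambda> f"
begin

lemma diff: "\<Lambda> (f - g) = \<Lambda> f - \<Lambda> g"
  using add[of "f - g" g] by simp

lemma transposition:
  assumes "lo < a" "a < b" "b \<le> M"
  shows "\<Lambda> (swap_vars a b f) = - \<Lambda> f"
proof -
  have "Suc a \<le> b" using assms by simp
  then show ?thesis
    using assms(3)
  proof (induction b arbitrary: f rule: dec_induct)
    case base
    then show ?case using assms(1) by (intro adjacent) auto
  next
    case (step b)
    then have "a < b" "lo < b" "b < M" using assms by auto
    then show ?case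
      using step by (simp add: swap_vars_conjugate adjacent)
  qed
qed

lemma symmetric_eq_0:
  assumes "lo < a" "a < b" "b \<le> M" "swap_vars a b f = f"
  shows "\<Lambda> f = 0"
proof -
  have "\<Lambda> f = - \<Lambda> f" using transposition[OF assms(1-3), of f] assms(4) by simp
  then have "2 * \<Lambda> f = 0" by simp
  then show ?thesis by simp
qed

end

text \<open>In the expansion a monomial with two equal exponents contributes nothing, so only the exponent
  vectors \<open>E j\<close> below survive.\<close>

lemma (in alternating) staircase_step:
  assumes M: "M = Suc N" and lo: "lo \<le> N"
  shows "\<Lambda> ((\<Prod>i\<in>{lo<..N}. zvar i ^ (N - i)) * (\<Prod>i\<in>{lo<..N}. zvar i - lconst s * zvar M))
    = (\<Sum>t\<le>N - lo. s ^ t) * \<Lambda> (\<Prod>i\<in>{lo<..M}. zvar i ^ (M - i))"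
proof -
  \<comment> \<open>The factors are expanded in order. \<open>P j\<close> is the monomial once z_i
    was chosen for all i \<le> j, \<open>R j\<close> the product of the factors after j, and
    \<open>E j\<close> the exponents when all of those contribute z_M.\<close>
  define P where "P j = (\<Prod>i\<in>{lo<..N}. zvar i ^ (if i \<le> j then M - i else N - i))" for j
  define R where "R j = (\<Prod>i\<in>{j<..N}. zvar i - lconst s * zvar M)" for j
  define E where "E j i = (if i \<le> j then M - i else if i \<le> N then N - i else N - j)" for i j
  define X where "X j = \<Lambda> (\<Prod>i\<in>{lo<..M}. zvar i ^ E j i)" for j
  have R_step: "R j = (zvar (Suc j) - lconst s * zvar M) * R (Suc j)" if "j < N" for j
  proof -
    have "{j<..N} = insert (Suc j) {Suc j<..N}" using that by auto
    then show ?thesis by (simp add: R_def)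
  qed
  have insertM: "{lo<..M} = insert M {lo<..N}" using M lo by auto
  have P_X: "\<Lambda> (P j * zvar M ^ (N - j)) = X j" if "j \<le> N" for j
  proof -
    have "(\<Prod>i\<in>{lo<..N}. zvar i ^ E j i) = P j"
      unfolding P_def by (intro prod.cong refl) (auto simp: E_def)
    moreover have "E j M = N - j" using that M by (simp add: E_def)
    ultimately have "(\<Prod>i\<in>{lo<..M}. zvar i ^ E j i) = zvar M ^ (N - j) * P j"
      unfolding insertM using M by simp
    then show ?thesis by (simp add: X_def mult.commute)
  qed
  have P_mult: "P j * zvar l = (\<Prod>i\<in>{lo<..N}. zvar i ^ ((if i \<le> j then M - i else N - i) + of_bool (i = l)))"
    if "l \<in> {lo<..N}" for j l
  proof -
    have "(\<Prod>i\<in>{lo<..N}. zvar i ^ of_bool (i = l)) = (\<Prod>i\<in>{lo<..N}. if i = l then zvar i else 1)"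
      by (rule prod.cong) auto
    also have "\<dots> = zvar l" using that by simp
    finally show ?thesis by (simp add: P_def power_add prod.distrib)
  qed
  have T_step: "\<Lambda> (P j * zvar M ^ c * R l) = - s * \<Lambda> (P j * zvar M ^ Suc c * R (Suc l))"
    if "lo \<le> j" "j < l" "l < N" for j l c
  proof -
    let ?f = "P j * zvar (Suc l)"
    have l: "l \<in> {lo<..N}" "Suc l \<in> {lo<..N}" using that by auto
    \<comment> \<open>Choosing z_(l+1) raises its exponent to N - l, that of z_l, so the term is
      symmetric. Once z_M has been chosen, it must be chosen ever after.\<close>
    have "swap_vars l (Suc l) ?f = ?f"
      unfolding P_mult[OF l(2)] swap_vars_monomial[OF l]
      using that by (intro prod.cong refl) (auto simp: swap_idx_def)
    moreover have "swap_vars l (Suc l) (R (Suc l)) = R (Suc l)"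
      unfolding R_def swap_vars_prod swap_vars_diff swap_vars_mult using that M
      by (intro prod.cong refl) auto
    moreover have "swap_vars l (Suc l) (zvar M ^ c) = zvar M ^ c"
      using that M by (simp add: swap_vars_power)
    ultimately have "\<Lambda> (?f * zvar M ^ c * R (Suc l)) = 0"
      using that M by (intro symmetric_eq_0[of l "Suc l"]) (auto simp: swap_vars_mult)
    moreover have "P j * zvar M ^ c * R l
        = ?f * zvar M ^ c * R (Suc l) - lconst s * (P j * zvar M ^ Suc c * R (Suc l))"
      unfolding R_step[OF that(3)] by (simp add: algebra_simps)
    ultimately show ?thesis by (simp add: diff scale)
  qed
  have T: "\<Lambda> (P j * zvar M ^ c * R l) = (- s) ^ (N - l) * \<Lambda> (P j * zvar M ^ (c + (N - l)))"
    if "lo \<le> j" "j < l" "l \<le> N" for j l c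
    using that(3,2)
  proof (induction l arbitrary: c rule: inc_induct)
    case base
    then show ?case by (simp add: R_def)
  next
    case (step l)
    have "\<Lambda> (P j * zvar M ^ c * R l) = - s * \<Lambda> (P j * zvar M ^ Suc c * R (Suc l))"
      using step that by (intro T_step) auto
    also have "\<dots> = - s * ((- s) ^ (N - Suc l) * \<Lambda> (P j * zvar M ^ (Suc c + (N - Suc l))))"
      using step by (subst step.IH) auto
    also have "\<dots> = (- s) ^ Suc (N - Suc l) * \<Lambda> (P j * zvar M ^ (Suc c + (N - Suc l)))"
      by simp
    also have "Suc (N - Suc l) = N - l" using step by auto
    also have "Suc c + (N - Suc l) = c + (N - l)" using step by auto
    finally show ?case .
  qed
  \<comment> \<open>\<open>E j\<close> and \<open>E (Suc j)\<close> differ by exchanging the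
    exponents of \<open>Suc j\<close> and \<open>M\<close>.\<close>
  have X_step: "X j = - X (Suc j)" if "lo \<le> j" "j < N" for j
  proof -
    have "Suc j \<in> {lo<..M}" "M \<in> {lo<..M}" using that M by auto
    then have "swap_vars (Suc j) M (\<Prod>i\<in>{lo<..M}. zvar i ^ E j i) = (\<Prod>i\<in>{lo<..M}. zvar i ^ E (Suc j) i)"
      using that M by (subst swap_vars_monomial) (auto intro!: prod.cong simp: E_def swap_idx_def)
    then show ?thesis
      using transposition[of "Suc j" M "\<Prod>i\<in>{lo<..M}. zvar i ^ E j i"] that M by (simp add: X_def)
  qed
  have X: "X j = (- 1) ^ (N - j) * X N" if "lo \<le> j" "j \<le> N" for j
    using that(2,1)
  proof (induction j rule: inc_induct)
    case (step j)
    have "N - j = Suc (N - Suc j)" using step by auto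
    then show ?case using X_step[of j] step by simp
  qed simp
  \<comment> \<open>Choosing z_(j+1) in the next factor leads to \<open>j + 1\<close>; choosing z_M
    forces all later choices and contributes s^(N-j), as the signs of \<open>T\<close> and
    \<open>X\<close> cancel.\<close>
  have Z: "\<Lambda> (P j * R j) = (\<Sum>t\<le>N - j. s ^ t) * X N" if "lo \<le> j" "j \<le> N" for j
    using that(2,1)
  proof (induction j rule: inc_induct)
    case base
    then show ?case using P_X[of N] by (simp add: R_def)
  next
    case (step j)
    have j: "Suc j \<in> {lo<..N}" using step by auto
    have "P j * zvar (Suc j) = P (Suc j)"
      unfolding P_mult[OF j] unfolding P_def using M by (intro prod.cong refl) (auto simp: Suc_diff_le)
    then have "P j * R j = P (Suc j) * R (Suc j) - lconst s * (P j * zvar M ^ 1 * R (Suc j))"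
      unfolding R_step[OF step.hyps(2)] by (simp add: algebra_simps)
    then have "\<Lambda> (P j * R j) = \<Lambda> (P (Suc j) * R (Suc j)) - s * \<Lambda> (P j * zvar M ^ 1 * R (Suc j))"
      by (simp only: diff scale)
    also have "\<Lambda> (P j * zvar M ^ 1 * R (Suc j)) = (- s) ^ (N - Suc j) * X j"
    proof -
      have "1 + (N - Suc j) = N - j" using step by simp
      then show ?thesis using T[of j "Suc j" 1] P_X[of j] step by simp
    qed
    also have "X j = (- 1) ^ (N - j) * X N" using step by (intro X) auto
    also have "\<Lambda> (P (Suc j) * R (Suc j)) = (\<Sum>t\<le>N - Suc j. s ^ t) * X N" using step by auto
    also have "(\<Sum>t\<le>N - Suc j. s ^ t) * X N - s * ((- s) ^ (N - Suc j) * ((- 1) ^ (N - j) * X N))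
        = (\<Sum>t\<le>N - j. s ^ t) * X N"
    proof -
      have Suc: "N - j = Suc (N - Suc j)" using step by auto
      have "(- s) ^ c * (- 1) ^ c = s ^ c" for c
        by (simp flip: power_mult_distrib)
      then have "s * ((- s) ^ (N - Suc j) * ((- 1) ^ Suc (N - Suc j) * X N)) = - (s ^ Suc (N - Suc j) * X N)"
        by (simp add: mult.assoc[symmetric])
      then show ?thesis
        unfolding Suc by (simp only: sum.atMost_Suc distrib_right diff_minus_eq_add)
    qed
    finally show ?case .
  qed
  have "P lo = (\<Prod>i\<in>{lo<..N}. zvar i ^ (N - i))"
    unfolding P_def by (intro prod.cong) auto
  moreover have "X N = \<Lambda> (\<Prod>i\<in>{lo<..M}. zvar i ^ (M - i))"
    unfolding X_def using M by (intro arg_cong[where f = \<Lambda>] prod.cong) (auto simp: E_def)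
  ultimately show ?thesis using Z[of lo] lo by (simp add: R_def)
qed

lemma finite_pairs [simp]: "finite A \<Longrightarrow> finite (pairs A)"
  unfolding pairs_def by (rule finite_subset[of _ "A \<times> A"]) auto

lemma prod_pairs_Suc:
  assumes "lo \<le> N"
  shows "(\<Prod>(i, j)\<in>pairs {lo<..Suc N}. g i j) = (\<Prod>(i, j)\<in>pairs {lo<..N}. g i j) * (\<Prod>i\<in>{lo<..N}. g i (Suc N))"
proof -
  have *: "pairs {lo<..Suc N} = pairs {lo<..N} \<union> (\<lambda>i. (i, Suc N)) ` {lo<..N}"
    using assms by (auto simp: pairs_def)
  show ?thesis
    unfolding * by (subst prod.union_disjoint) (auto simp: pairs_def[of "{lo<..N}"] prod.reindex inj_on_def
        intro: finite_subset[of _ "{lo<..N} \<times> {lo<..N}"])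
qed

lemma prod_pairs_staircase:
  assumes "lo \<le> N"
  shows "(\<Prod>(i, j)\<in>pairs {lo<..N}. zvar i) = (\<Prod>i\<in>{lo<..N}. zvar i ^ (N - i))"
  using assms
proof (induction N rule: dec_induct)
  case (step N)
  have "{lo<..Suc N} = insert (Suc N) {lo<..N}" using step by auto
  then have "(\<Prod>i\<in>{lo<..Suc N}. zvar i ^ (Suc N - i)) = (\<Prod>i\<in>{lo<..N}. zvar i ^ (Suc N - i))"
    by simp
  also have "\<dots> = (\<Prod>i\<in>{lo<..N}. zvar i ^ (N - i) * zvar i)"
    by (intro prod.cong) (auto simp: Suc_diff_le)
  finally show ?case using step by (simp add: prod_pairs_Suc prod.distrib)
qed (simp add: pairs_def)

text \<open>Induction on the upper end for all functionals at once. The factors with the last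
  variable are absorbed into the functional, and \<open>staircase_step\<close> then contributes the
  next q-number as a geometric sum.\<close>

lemma (in alternating) antisymmetrise:
  assumes "lo \<le> M" "s \<noteq> 1"
  shows "\<Lambda> (\<Prod>(i, j)\<in>pairs {lo<..M}. zvar i - lconst s * zvar j)
    = qfact s (M - lo) * \<Lambda> (\<Prod>(i, j)\<in>pairs {lo<..M}. zvar i)"
proof -
  have "\<Lambda>' (\<Prod>(i, j)\<in>pairs {lo<..N}. zvar i - lconst s * zvar j)
      = qfact s (N - lo) * \<Lambda>' (\<Prod>(i, j)\<in>pairs {lo<..N}. zvar i)"
    if "lo \<le> N" "alternating \<Lambda>' lo N" for N \<Lambda>'
    using that
  proof (induction N arbitrary: \<Lambda>' rule: dec_induct)
    case base
    then show ?case by (simp add: pairs_def qfact_def)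
  next
    case (step N)
    interpret A: alternating \<Lambda>' lo "Suc N" by (rule step.prems)
    let ?R = "\<Prod>i\<in>{lo<..N}. zvar i - lconst s * zvar (Suc N)"
    \<comment> \<open>\<open>?R\<close> is symmetric in the variables before the last one, so
      multiplying by it keeps the functional alternating in them.\<close>
    have "alternating (\<lambda>f. \<Lambda>' (f * ?R)) lo N"
    proof
      fix a f assume a: "lo < a" "a < N"
      have in_iff: "swap_idx a (Suc a) i \<in> {lo<..N} \<longleftrightarrow> i \<in> {lo<..N}" for i
        by (rule swap_idx_in_iff) (use a in auto)
      have "swap_vars a (Suc a) ?R = (\<Prod>i\<in>{lo<..N}. zvar (swap_idx a (Suc a) i) - lconst s * zvar (Suc N))"
        unfolding swap_vars_prod swap_vars_diff swap_vars_mult using a by simp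
      also have "\<dots> = ?R"
        by (rule prod.reindex_bij_witness[of _ "swap_idx a (Suc a)" "swap_idx a (Suc a)"])
          (simp_all only: in_iff swap_idx_swap_idx)
      finally have "swap_vars a (Suc a) f * ?R = swap_vars a (Suc a) (f * ?R)"
        by (simp add: swap_vars_mult)
      then show "\<Lambda>' (swap_vars a (Suc a) f * ?R) = - \<Lambda>' (f * ?R)"
        using A.adjacent[of a "f * ?R"] a by simp
    qed (simp_all add: A.add distrib_right A.scale mult.assoc)
    note IH = step.IH[OF this]
    have geo: "(\<Sum>t\<le>N - lo. s ^ t) = qnum s (Suc N - lo)"
    proof -
      have "(1 - s) * (\<Sum>t\<le>N - lo. s ^ t) = 1 - s ^ Suc (N - lo)"
        by (rule sum_gp_basic)
      then show ?thesis using assms(2) step.hyps by (simp add: qnum_def field_simps Suc_diff_le)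
    qed
    have "\<Lambda>' (\<Prod>(i, j)\<in>pairs {lo<..Suc N}. zvar i - lconst s * zvar j)
        = qfact s (N - lo) * \<Lambda>' ((\<Prod>i\<in>{lo<..N}. zvar i ^ (N - i)) * ?R)"
      unfolding prod_pairs_Suc[OF step.hyps(1)] IH prod_pairs_staircase[OF step.hyps(1)] ..
    also have "\<dots> = qfact s (N - lo) * (qnum s (Suc N - lo) * \<Lambda>' (\<Prod>i\<in>{lo<..Suc N}. zvar i ^ (Suc N - i)))"
      using A.staircase_step[OF refl step.hyps(1), of s] geo by simp
    also have "qfact s (N - lo) * (qnum s (Suc N - lo) * x) = qfact s (Suc N - lo) * x" for x
      using step.hyps by (simp add: qfact_def Suc_diff_le)
    finally show ?case using step.hyps by (simp add: prod_pairs_staircase)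
  qed
  then show ?thesis using assms alternating_axioms by blast
qed

section \<open>Reduction to the weight function\<close>

lemma lconst_mult: "lconst a * lconst b = lconst (a * b)"
  by (simp add: lconst_def mult_single)

lemma lconst_power: "lconst a ^ n = lconst (a ^ n)"
  by (induction n) (simp_all add: lconst_mult, simp add: lconst_def)

lemma zvar_zinv [simp]: "zvar i * zinv i = 1"
  by (simp add: zvar_def zinv_def zpow_def mult_single flip: single_add)

lemma zinv_zvar [simp]: "zinv i * zvar i = 1"
  using zvar_zinv[of i] by (simp only: mult.commute)

lemma rfac_eq: "rfac c i j = 1 - lconst c * (zvar i * zinv j)"
  by (simp add: rfac_def lconst_def zvar_def zinv_def zpow_def mult_single single_uminus)

lemma qpoch_pfac:
  "qpoch (zvar i * zinv j) (lconst q_ind) k * qpoch (lconst q_ind * (zvar j * zinv i)) (lconst q_ind) k = pfac i j k k"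
proof -
  have 1: "zvar i * zinv j * lconst q_ind ^ l = lconst (q_ind ^ l) * (zvar i * zinv j)" for l
    unfolding lconst_power by (rule mult.commute)
  have 2: "lconst q_ind * (zvar j * zinv i) * lconst q_ind ^ l = lconst (q_ind ^ Suc l) * (zvar j * zinv i)" for l
    unfolding lconst_power power_Suc lconst_mult[symmetric] by (simp only: mult_ac)
  show ?thesis
    unfolding qpoch_def pfac_def rfac_eq 1 2 ..
qed

lemma swap_vars_rfac [simp]: "swap_vars a b (rfac c i j) = rfac c (swap_idx a b i) (swap_idx a b j)"
  by (simp add: rfac_eq swap_vars_diff swap_vars_mult)

lemma swap_vars_pfac [simp]: "swap_vars a b (pfac i j u v) = pfac (swap_idx a b i) (swap_idx a b j) u v"
  by (simp add: pfac_def swap_vars_prod swap_vars_mult)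

text \<open>The extra factor lengthens (z_i/z_j; q)_k by one. Splitting off the first factor instead
  leaves 1/z_i - 1/z_j times a product symmetric in i and j.\<close>

lemma pfac_antisymmetric:
  "(zinv j - lconst (q_ind ^ k) * zinv i) * pfac j i k k = - ((zinv i - lconst (q_ind ^ k) * zinv j) * pfac i j k k)"
proof -
  have "(zinv i - lconst (q_ind ^ k) * zinv j) * pfac i j k k
      = (zinv i - zinv j) * ((\<Prod>l<k. rfac (q_ind ^ Suc l) i j) * (\<Prod>l<k. rfac (q_ind ^ Suc l) j i))" for i j
  proof -
    have "zinv i * rfac c i j = zinv i - lconst c * zinv j * (zvar i * zinv i)" for c
      unfolding rfac_eq by (simp only: right_diff_distrib mult_1_right mult_1_left mult_ac)
    then have z: "zinv i * rfac c i j = zinv i - lconst c * zinv j" for c by simp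
    have "(zinv i - lconst (q_ind ^ k) * zinv j) * (\<Prod>l<k. rfac (q_ind ^ l) i j)
        = zinv i * (\<Prod>l<Suc k. rfac (q_ind ^ l) i j)"
      unfolding z[symmetric] by (simp only: prod.lessThan_Suc mult_ac)
    also have "\<dots> = zinv i * rfac (q_ind ^ 0) i j * (\<Prod>l<k. rfac (q_ind ^ Suc l) i j)"
      unfolding prod.lessThan_Suc_shift by (simp only: mult.assoc)
    also have "zinv i * rfac (q_ind ^ 0) i j = zinv i - zinv j"
      unfolding z by (simp add: lconst_def)
    finally show ?thesis
      unfolding pfac_def by (simp only: mult.assoc[symmetric])
  qed
  note * = this
  show ?thesis unfolding *[of j i] *[of i j] by (simp add: algebra_simps)
qed

text \<open>An adjacent transposition preserves the order of every pair except (a, a + 1), so it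
  permutes the remaining pairs.\<close>

lemma swap_vars_fixes_pairs:
  assumes "a \<in> I" "Suc a \<in> I" "\<And>i j. swap_vars a (Suc a) (g i j) = g (swap_idx a (Suc a) i) (swap_idx a (Suc a) j)"
  shows "swap_vars a (Suc a) (\<Prod>(i, j)\<in>pairs I - {(a, Suc a)}. g i j) = (\<Prod>(i, j)\<in>pairs I - {(a, Suc a)}. g i j)"
proof -
  let ?s = "swap_idx a (Suc a)"
  have mem: "(?s i, ?s j) \<in> pairs I - {(a, Suc a)}" if "(i, j) \<in> pairs I - {(a, Suc a)}" for i j
    using that assms(1,2) by (auto simp: pairs_def swap_idx_def)
  have "(\<Prod>(i, j)\<in>pairs I - {(a, Suc a)}. g (?s i) (?s j)) = (\<Prod>(i, j)\<in>pairs I - {(a, Suc a)}. g i j)"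
  proof (rule prod.reindex_bij_witness[of _ "map_prod ?s ?s" "map_prod ?s ?s"])
    fix x assume x: "x \<in> pairs I - {(a, Suc a)}"
    show "map_prod ?s ?s x \<in> pairs I - {(a, Suc a)}"
      using x mem by (cases x) (simp only: map_prod_simp)
    then show "map_prod ?s ?s x \<in> pairs I - {(a, Suc a)}" .
  qed (auto simp: map_prod_def)
  then show ?thesis
    unfolding swap_vars_prod by (simp add: case_prod_unfold assms(3))
qed

section \<open>From the product of the theorem to the weight function\<close>

context
  fixes ns :: "nat \<Rightarrow> nat" and p k :: nat
begin

definition start :: "nat \<Rightarrow> nat" where
  "start \<alpha> = (\<Sum>\<beta><\<alpha>. ns \<beta>)"

lemma start_Suc: "start (Suc \<alpha>) = start \<alpha> + ns \<alpha>"
  by (simp add: start_def)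

lemma start_mono: "\<alpha> \<le> \<beta> \<Longrightarrow> start \<alpha> \<le> start \<beta>"
  unfolding start_def by (rule sum_mono2) auto

lemma block_eq: "block ns \<alpha> = {start \<alpha><..start (Suc \<alpha>)}"
  by (auto simp: block_def start_def lessThan_Suc_atMost)

lemma block_disjoint:
  assumes "i \<in> block ns \<alpha>" "i \<in> block ns \<beta>"
  shows "\<alpha> = \<beta>"
proof (rule ccontr)
  assume "\<alpha> \<noteq> \<beta>"
  then consider "Suc \<alpha> \<le> \<beta>" | "Suc \<beta> \<le> \<alpha>" by linarith
  then show False
    using assms start_mono[of "Suc \<alpha>" \<beta>] start_mono[of "Suc \<beta>" \<alpha>] by cases (auto simp: block_eq)
qed

text \<open>\<open>A\<close> records the blocks in which the product has already been replaced by
  its staircase monomial.\<close>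

definition outer :: "nat set \<Rightarrow> nat \<Rightarrow> laurent" where
  "outer A \<alpha> = (\<Prod>(i, j)\<in>pairs (block ns \<alpha>). if \<alpha> \<in> A then zvar i else zvar i - lconst (q_ind ^ (k + 1)) * zvar j)"

definition inner :: "nat \<Rightarrow> laurent" where
  "inner \<alpha> = (\<Prod>(i, j)\<in>pairs (block ns \<alpha>). zinv i - lconst (q_ind ^ k) * zinv j)"

definition dyson :: "nat \<Rightarrow> laurent" where
  "dyson n = (\<Prod>(i, j)\<in>pairs {0<..n}. pfac i j k k)"

text \<open>The other blocks do not involve the exchanged variables. In the remaining product only
  the pair (a, a + 1) changes, and it changes sign by \<open>pfac_antisymmetric\<close>.\<close>

lemma alternating_block:
  assumes \<alpha>: "\<alpha> \<in> {1..p}"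
  shows "alternating (\<lambda>f. CT (f * ((\<Prod>\<beta>\<in>{1..p} - {\<alpha>}. outer A \<beta> * inner \<beta>) * (inner \<alpha> * dyson (start (Suc p))))))
    (start \<alpha>) (start (Suc \<alpha>))"
proof
  fix f a assume a: "start \<alpha> < a" "a < start (Suc \<alpha>)"
  let ?V = "{0<..start (Suc p)}"
  have aB: "a \<in> block ns \<alpha>" "Suc a \<in> block ns \<alpha>" using a by (auto simp: block_eq)
  have aV: "a \<in> ?V" "Suc a \<in> ?V" using a \<alpha> start_mono[of "Suc \<alpha>" "Suc p"] by auto
  let ?B = "\<Prod>\<beta>\<in>{1..p} - {\<alpha>}. outer A \<beta> * inner \<beta>"
  have fixed: "swap_idx a (Suc a) i = i" if "i \<in> block ns \<beta>" "\<beta> \<noteq> \<alpha>" for i \<beta>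
    using that aB block_disjoint by (intro swap_idx_other) auto
  have B: "swap_vars a (Suc a) ?B = ?B"
    unfolding swap_vars_prod
  proof (rule prod.cong[OF refl])
    fix \<beta> assume \<beta>: "\<beta> \<in> {1..p} - {\<alpha>}"
    show "swap_vars a (Suc a) (outer A \<beta> * inner \<beta>) = outer A \<beta> * inner \<beta>"
      unfolding outer_def inner_def swap_vars_mult swap_vars_prod
      using \<beta> fixed by (intro arg_cong2[where f = "(*)"] prod.cong refl)
        (auto simp: pairs_def swap_vars_diff swap_vars_mult)
  qed
  let ?I = "\<lambda>i j. zinv i - lconst (q_ind ^ k) * zinv j"
  let ?P = "\<lambda>i j. pfac i j k k"
  let ?x = "(a, Suc a)"
  have fin: "finite (pairs (block ns \<alpha>))" "finite (pairs ?V)"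
    by (simp_all add: block_eq)
  have mem: "?x \<in> pairs (block ns \<alpha>)" "?x \<in> pairs ?V"
    using aB aV by (auto simp: pairs_def)
  have *: "inner \<alpha> * dyson (start (Suc p))
      = ((\<Prod>(i, j)\<in>pairs (block ns \<alpha>) - {?x}. ?I i j) * (\<Prod>(i, j)\<in>pairs ?V - {?x}. ?P i j)) * (?I a (Suc a) * ?P a (Suc a))"
    unfolding inner_def dyson_def prod.remove[OF fin(1) mem(1)] prod.remove[OF fin(2) mem(2)] split_conv
    by (simp only: mult_ac)
  have **: "swap_vars a (Suc a) (\<Prod>(i, j)\<in>pairs (block ns \<alpha>) - {?x}. ?I i j) = (\<Prod>(i, j)\<in>pairs (block ns \<alpha>) - {?x}. ?I i j)"
    "swap_vars a (Suc a) (\<Prod>(i, j)\<in>pairs ?V - {?x}. ?P i j) = (\<Prod>(i, j)\<in>pairs ?V - {?x}. ?P i j)"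
    by (rule swap_vars_fixes_pairs; simp add: aB aV[simplified] swap_vars_diff swap_vars_mult)+
  have "swap_vars a (Suc a) (?I a (Suc a) * ?P a (Suc a)) = ?I (Suc a) a * ?P (Suc a) a"
    by (simp add: swap_vars_diff swap_vars_mult)
  also have "\<dots> = - (?I a (Suc a) * ?P a (Suc a))"
    by (rule pfac_antisymmetric)
  finally have ID: "swap_vars a (Suc a) (inner \<alpha> * dyson (start (Suc p))) = - (inner \<alpha> * dyson (start (Suc p)))"
    unfolding * swap_vars_mult ** by simp
  have "CT (f * (?B * (inner \<alpha> * dyson (start (Suc p)))))
      = CT (swap_vars a (Suc a) (f * (?B * (inner \<alpha> * dyson (start (Suc p))))))"
    by (rule CT_swap_vars[symmetric])
  also have "\<dots> = CT (swap_vars a (Suc a) f * (?B * - (inner \<alpha> * dyson (start (Suc p)))))"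
    by (simp only: swap_vars_mult[of _ _ f] swap_vars_mult[of _ _ ?B] B ID)
  also have "\<dots> = - CT (swap_vars a (Suc a) f * (?B * (inner \<alpha> * dyson (start (Suc p)))))"
    by (simp add: CT_def)
  finally show "CT (swap_vars a (Suc a) f * (?B * (inner \<alpha> * dyson (start (Suc p)))))
      = - CT (f * (?B * (inner \<alpha> * dyson (start (Suc p)))))"
    by simp
next
  fix c f
  show "CT (lconst c * f * ((\<Prod>\<beta>\<in>{1..p} - {\<alpha>}. outer A \<beta> * inner \<beta>) * (inner \<alpha> * dyson (start (Suc p)))))
    = c * CT (f * ((\<Prod>\<beta>\<in>{1..p} - {\<alpha>}. outer A \<beta> * inner \<beta>) * (inner \<alpha> * dyson (start (Suc p)))))"
    unfolding CT_eq_lin mult.assoc lconst_def lin_single_mult by simp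
qed (simp add: CT_def distrib_right lookup_add)

lemma CT_outer:
  assumes "A \<subseteq> {1..p}"
  shows "CT ((\<Prod>\<alpha>=1..p. outer {} \<alpha> * inner \<alpha>) * dyson (start (Suc p)))
    = (\<Prod>\<alpha>\<in>A. qfact (q_ind ^ (k + 1)) (ns \<alpha>)) * CT ((\<Prod>\<alpha>=1..p. outer A \<alpha> * inner \<alpha>) * dyson (start (Suc p)))"
proof -
  have "finite A" using assms by (rule finite_subset) simp
  then show ?thesis
    using assms
  proof (induction A)
    case (insert \<alpha> A)
    let ?\<Lambda> = "\<lambda>f. CT (f * ((\<Prod>\<beta>\<in>{1..p} - {\<alpha>}. outer A \<beta> * inner \<beta>) * (inner \<alpha> * dyson (start (Suc p)))))"
    have \<alpha>: "\<alpha> \<in> {1..p}" using insert.prems by auto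
    have split: "CT ((\<Prod>\<beta>=1..p. outer A' \<beta> * inner \<beta>) * dyson (start (Suc p))) = ?\<Lambda> (outer A' \<alpha>)"
      if "A' = A \<or> A' = insert \<alpha> A" for A'
    proof -
      have "(\<Prod>\<beta>\<in>{1..p} - {\<alpha>}. outer A' \<beta> * inner \<beta>) = (\<Prod>\<beta>\<in>{1..p} - {\<alpha>}. outer A \<beta> * inner \<beta>)"
        using that by (intro prod.cong) (auto simp: outer_def)
      then show ?thesis
        by (subst prod.remove[of _ \<alpha>]) (use \<alpha> in \<open>simp_all add: mult_ac\<close>)
    qed
    interpret alternating ?\<Lambda> "start \<alpha>" "start (Suc \<alpha>)"
      using \<alpha> by (rule alternating_block)
    have "q_ind ^ (k + 1) \<noteq> 1" unfolding q_ind_power_eq_1_iff by simp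
    then have "?\<Lambda> (outer A \<alpha>) = qfact (q_ind ^ (k + 1)) (ns \<alpha>) * ?\<Lambda> (outer (insert \<alpha> A) \<alpha>)"
      using antisymmetrise[of "q_ind ^ (k + 1)"] insert.hyps start_mono[of \<alpha> "Suc \<alpha>"]
      by (simp add: outer_def block_eq start_Suc)
    then show ?case
      using insert split[of A] split[of "insert \<alpha> A"] by (simp add: mult_ac)
  qed simp
qed

text \<open>The variables outside all \<open>p\<close> blocks become blocks of size one.\<close>

definition label :: "nat \<Rightarrow> nat" where
  "label i = (if i \<le> ns 0 then i else ns 0 + (LEAST \<alpha>. i \<le> start (Suc \<alpha>)))"

lemma label_block:
  assumes "i \<in> block ns \<alpha>" "1 \<le> \<alpha>"
  shows "label i = ns 0 + \<alpha>"
proof -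
  have "ns 0 < i"
    using assms start_mono[of 1 \<alpha>] by (simp add: block_eq start_Suc start_def[of 0])
  moreover have "(LEAST \<beta>. i \<le> start (Suc \<beta>)) = \<alpha>"
  proof (rule Least_equality)
    show "\<alpha> \<le> \<beta>" if "i \<le> start (Suc \<beta>)" for \<beta>
      using that assms start_mono[of "Suc \<beta>" \<alpha>] by (force simp: block_eq)
  qed (use assms in \<open>auto simp: block_eq\<close>)
  ultimately show ?thesis by (simp add: label_def)
qed

lemma label_single: "i \<le> ns 0 \<Longrightarrow> label i = i"
  by (simp add: label_def)

lemma index_cases:
  assumes "i \<in> {0<..start (Suc p)}"
  obtains "0 < i" "i \<le> ns 0" | \<alpha> where "\<alpha> \<in> {1..p}" "i \<in> block ns \<alpha>"
proof (cases "i \<le> ns 0")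
  case False
  define \<alpha> where "\<alpha> = (LEAST \<alpha>. i \<le> start (Suc \<alpha>))"
  have i: "i \<le> start (Suc p)" using assms by simp
  have 1: "i \<le> start (Suc \<alpha>)" unfolding \<alpha>_def using i by (rule LeastI)
  have 2: "\<alpha> \<le> p" unfolding \<alpha>_def using i by (rule Least_le)
  have "\<alpha> \<noteq> 0"
  proof
    assume "\<alpha> = 0"
    then show False using 1 False by (simp add: start_def)
  qed
  moreover from this have "\<not> i \<le> start (Suc (\<alpha> - 1))"
    unfolding \<alpha>_def by (intro not_less_Least) simp
  ultimately show thesis using that(2)[of \<alpha>] 1 2 by (auto simp: block_eq)
qed (use assms that in auto)

lemma label_mono:
  assumes "i \<in> {0<..start (Suc p)}" "j \<in> {0<..start (Suc p)}" "i \<le> j"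
  shows "label i \<le> label j"
proof (cases "j \<le> ns 0")
  case True
  then show ?thesis using assms by (simp add: label_def)
next
  case False
  have "j \<le> start (Suc p)" using assms by simp
  then have "j \<le> start (Suc (LEAST \<alpha>. j \<le> start (Suc \<alpha>)))" by (rule LeastI)
  then have "(LEAST \<alpha>. i \<le> start (Suc \<alpha>)) \<le> (LEAST \<alpha>. j \<le> start (Suc \<alpha>))"
    using assms(3) by (intro Least_le) simp
  then show ?thesis using False by (simp add: label_def)
qed

lemma label_eq_iff:
  assumes "i \<in> {0<..start (Suc p)}" "j \<in> {0<..start (Suc p)}" "i < j"
  shows "label i = label j \<longleftrightarrow> (\<exists>\<alpha>\<in>{1..p}. i \<in> block ns \<alpha> \<and> j \<in> block ns \<alpha>)"
proof
  assume eq: "label i = label j"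
  from assms(2) show "\<exists>\<alpha>\<in>{1..p}. i \<in> block ns \<alpha> \<and> j \<in> block ns \<alpha>"
  proof (cases rule: index_cases)
    case 1
    then show ?thesis using eq assms(3) by (simp add: label_single)
  next
    case (2 \<beta>)
    from assms(1) show ?thesis
    proof (cases rule: index_cases)
      case 1
      then show ?thesis using eq 2 by (simp add: label_single label_block)
    next
      case (2 \<alpha>)
      then show ?thesis using eq \<open>\<beta> \<in> {1..p}\<close> \<open>j \<in> block ns \<beta>\<close> by (auto simp: label_block)
    qed
  qed
qed (auto simp: label_block)

text \<open>The z_i of the staircase monomial combines with 1/z_i - q^k/z_j to 1 - q^k z_i/z_j, the
  factor that lengthens (z_i/z_j; q)_k inside a block.\<close>

lemma wt_label: "(\<Prod>\<alpha>=1..p. outer {1..p} \<alpha> * inner \<alpha>) * dyson (start (Suc p)) = wt k label {0<..start (Suc p)}"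
proof -
  let ?V = "{0<..start (Suc p)}"
  have sub: "block ns \<alpha> \<subseteq> ?V" if "\<alpha> \<in> {1..p}" for \<alpha>
    using that start_mono[of "Suc \<alpha>" "Suc p"] by (auto simp: block_eq)
  have zz: "zvar i * (zinv i - lconst c * zinv j) = rfac c i j" for i j c
    by (simp add: rfac_eq right_diff_distrib mult_ac)
  have "(\<Prod>\<alpha>=1..p. outer {1..p} \<alpha> * inner \<alpha>) = (\<Prod>\<alpha>=1..p. \<Prod>(i, j)\<in>pairs (block ns \<alpha>). rfac (q_ind ^ k) i j)"
    by (intro prod.cong refl) (simp add: outer_def inner_def case_prod_unfold zz flip: prod.distrib)
  also have "\<dots> = (\<Prod>(i, j)\<in>(\<Union>\<alpha>\<in>{1..p}. pairs (block ns \<alpha>)). rfac (q_ind ^ k) i j)"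
  proof (rule prod.UNION_disjoint[symmetric])
    show "\<forall>\<alpha>\<in>{1..p}. \<forall>\<beta>\<in>{1..p}. \<alpha> \<noteq> \<beta> \<longrightarrow> pairs (block ns \<alpha>) \<inter> pairs (block ns \<beta>) = {}"
      using block_disjoint by (fastforce simp: pairs_def)
  qed (simp_all add: block_eq)
  also have "(\<Union>\<alpha>\<in>{1..p}. pairs (block ns \<alpha>)) = {x \<in> pairs ?V. label (fst x) = label (snd x)}"
  proof (intro set_eqI)
    fix x :: "nat \<times> nat"
    obtain i j where x: "x = (i, j)" by (cases x)
    have "x \<in> (\<Union>\<alpha>\<in>{1..p}. pairs (block ns \<alpha>)) \<longleftrightarrow> i < j \<and> (\<exists>\<alpha>\<in>{1..p}. i \<in> block ns \<alpha> \<and> j \<in> block ns \<alpha>)"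
      unfolding x pairs_def by blast
    also have "\<dots> \<longleftrightarrow> i \<in> ?V \<and> j \<in> ?V \<and> i < j \<and> label i = label j"
      using sub label_eq_iff[of i j] by blast
    also have "\<dots> \<longleftrightarrow> x \<in> {x \<in> pairs ?V. label (fst x) = label (snd x)}"
      unfolding x pairs_def by simp
    finally show "x \<in> (\<Union>\<alpha>\<in>{1..p}. pairs (block ns \<alpha>)) \<longleftrightarrow> x \<in> {x \<in> pairs ?V. label (fst x) = label (snd x)}" .
  qed
  also have "(\<Prod>(i, j)\<in>{x \<in> pairs ?V. label (fst x) = label (snd x)}. rfac (q_ind ^ k) i j)
      = (\<Prod>(i, j)\<in>pairs ?V. if label i = label j then rfac (q_ind ^ k) i j else 1)"
    unfolding case_prod_unfold by (rule prod.inter_filter) simp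
  finally have "(\<Prod>\<alpha>=1..p. outer {1..p} \<alpha> * inner \<alpha>) * dyson (start (Suc p))
      = (\<Prod>(i, j)\<in>pairs ?V. (if label i = label j then rfac (q_ind ^ k) i j else 1) * pfac i j k k)"
    by (simp add: dyson_def case_prod_unfold prod.distrib)
  also have "\<dots> = wt k label ?V"
    unfolding wt_def
  proof (rule prod.cong)
    show "pairs ?V = {(i, j) \<in> ?V \<times> ?V. prec label i j}"
    proof (intro set_eqI)
      fix x :: "nat \<times> nat"
      obtain i j where x: "x = (i, j)" by (cases x)
      have "i < j \<longleftrightarrow> prec label i j" if "i \<in> ?V" "j \<in> ?V"
        using label_mono[OF that] label_mono[OF that(2,1)] by (auto simp: prec_def not_less[symmetric] dest: leD)
      then show "x \<in> pairs ?V \<longleftrightarrow> x \<in> {(i, j) \<in> ?V \<times> ?V. prec label i j}"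
        unfolding x pairs_def by blast
    qed
    show "(case x of (i, j) \<Rightarrow> (if label i = label j then rfac (q_ind ^ k) i j else 1) * pfac i j k k)
        = (case x of (i, j) \<Rightarrow> pfac i j (k + of_bool (label i = label j)) k)" for x
      by (auto simp: pfac_def mult_ac split: prod.split)
  qed
  finally show ?thesis .
qed

lemma D_const_eq:
  "D_const p ns k = (\<Prod>\<alpha>=1..p. qfact (q_ind ^ (k + 1)) (ns \<alpha>)) * CT (wt k label {0<..start (Suc p)})"
proof -
  have V: "{1..\<Sum>\<alpha>\<le>p. ns \<alpha>} = {0<..start (Suc p)}"
    by (auto simp: start_def lessThan_Suc_atMost)
  have "D_const p ns k = CT ((\<Prod>\<alpha>=1..p. outer {} \<alpha> * inner \<alpha>) * dyson (start (Suc p)))"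
    unfolding D_const_def V qpoch_pfac dyson_def outer_def inner_def
    by (simp add: case_prod_unfold prod.distrib)
  also have "\<dots> = (\<Prod>\<alpha>=1..p. qfact (q_ind ^ (k + 1)) (ns \<alpha>)) * CT (wt k label {0<..start (Suc p)})"
    using CT_outer[of "{1..p}"] unfolding wt_label by simp
  finally show ?thesis .
qed

lemma rank_label_single:
  assumes "0 < i" "i \<le> ns 0"
  shows "rank label {0<..start (Suc p)} i = 0"
proof -
  have "label u \<noteq> label i" if "u < i" for u
    using that assms label_single[of u] label_single[of i] by simp
  then have "{u \<in> {0<..start (Suc p)}. label u = label i \<and> u < i} = {}"
    by blast
  then show ?thesis by (simp add: rank_def)
qed

lemma rank_label_block:
  assumes "\<alpha> \<in> {1..p}" "i \<in> block ns \<alpha>"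
  shows "rank label {0<..start (Suc p)} i = i - start \<alpha> - 1"
proof -
  have "i \<le> start (Suc p)" using assms start_mono[of "Suc \<alpha>" "Suc p"] by (auto simp: block_eq)
  then have i: "i \<in> {0<..start (Suc p)}" using assms(2) by (auto simp: block_eq)
  have "{u \<in> {0<..start (Suc p)}. label u = label i \<and> u < i} = {start \<alpha><..<i}"
  proof (intro set_eqI iffI)
    fix u assume u: "u \<in> {u \<in> {0<..start (Suc p)}. label u = label i \<and> u < i}"
    then obtain \<beta> where "u \<in> block ns \<beta>" "i \<in> block ns \<beta>"
      using label_eq_iff[of u i] i by blast
    then have "u \<in> block ns \<alpha>" using block_disjoint[of i \<alpha> \<beta>] assms(2) by simp
    then show "u \<in> {start \<alpha><..<i}" using u by (simp add: block_eq)
  next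
    fix u assume u: "u \<in> {start \<alpha><..<i}"
    then have "u \<in> block ns \<alpha>" using assms(2) by (simp add: block_eq)
    then have "label u = label i" using assms by (simp add: label_block)
    then show "u \<in> {u \<in> {0<..start (Suc p)}. label u = label i \<and> u < i}" using u i by simp
  qed
  then show ?thesis by (simp add: rank_def)
qed

lemma layers_label:
  assumes "1 \<le> i"
  shows "layers label {0<..start (Suc p)} i = start (Suc p) - m_sum p ns i"
proof -
  let ?V = "{0<..start (Suc p)}"
  \<comment> \<open>The complement is counted: a block of size at least \<open>i\<close> loses its
    elements after the first \<open>i\<close>, shorter blocks lose none, and single variables have
    rank 0 < \<open>i\<close>.\<close>
  let ?H = "{v \<in> ?V. i \<le> rank label ?V v}"
  have H: "?H = (\<Union>\<alpha>\<in>{1..p}. {start \<alpha> + i<..start (Suc \<alpha>)})"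
  proof (intro set_eqI iffI)
    fix v assume v: "v \<in> ?H"
    then have "v \<in> ?V" by simp
    then show "v \<in> (\<Union>\<alpha>\<in>{1..p}. {start \<alpha> + i<..start (Suc \<alpha>)})"
    proof (cases rule: index_cases)
      case 1
      then show ?thesis using v assms rank_label_single by simp
    next
      case (2 \<alpha>)
      then have "i \<le> v - start \<alpha> - 1" using v rank_label_block by simp
      then show ?thesis using 2 assms by (auto simp: block_eq intro!: bexI[of _ \<alpha>])
    qed
  next
    fix v assume "v \<in> (\<Union>\<alpha>\<in>{1..p}. {start \<alpha> + i<..start (Suc \<alpha>)})"
    then obtain \<alpha> where \<alpha>: "\<alpha> \<in> {1..p}" "start \<alpha> + i < v" "v \<le> start (Suc \<alpha>)" by auto
    then have "v \<in> block ns \<alpha>" by (simp add: block_eq)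
    then show "v \<in> ?H"
      using \<alpha> rank_label_block[of \<alpha> v] start_mono[of "Suc \<alpha>" "Suc p"] by auto
  qed
  have "card ?H = (\<Sum>\<alpha>=1..p. card {start \<alpha> + i<..start (Suc \<alpha>)})"
    unfolding H
  proof (rule card_UN_disjoint)
    show "\<forall>\<alpha>\<in>{1..p}. \<forall>\<beta>\<in>{1..p}. \<alpha> \<noteq> \<beta>
        \<longrightarrow> {start \<alpha> + i<..start (Suc \<alpha>)} \<inter> {start \<beta> + i<..start (Suc \<beta>)} = {}"
    proof (intro ballI impI equals0I)
      fix \<alpha> \<beta> v assume "\<alpha> \<noteq> \<beta>" "v \<in> {start \<alpha> + i<..start (Suc \<alpha>)} \<inter> {start \<beta> + i<..start (Suc \<beta>)}"
      then show False using block_disjoint[of v \<alpha> \<beta>] by (simp add: block_eq)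
    qed
  qed auto
  also have "\<dots> = (\<Sum>\<alpha>=1..p. ns \<alpha> - i)"
    by (intro sum.cong) (auto simp: start_Suc)
  also have "\<dots> = m_sum p ns i"
    unfolding m_sum_def by (rule sum.mono_neutral_right) auto
  finally have "card ?H = m_sum p ns i" .
  moreover have "{v \<in> ?V. rank label ?V v < i} = ?V - ?H" by auto
  moreover have "card (?V - ?H) = card ?V - card ?H" by (rule card_Diff_subset) auto
  ultimately show ?thesis by (simp add: layers_def)
qed

end

theorem theorem12:
  fixes p k n M :: nat and ns :: "nat \<Rightarrow> nat"
  assumes "p \<ge> 1" and "k \<ge> 1"
    and "\<And>\<alpha>. \<alpha> \<in> {1..p} \<Longrightarrow> ns \<alpha> \<ge> 1"
    and "n = (\<Sum>\<alpha>\<le>p. ns \<alpha>)"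
    and "M = Max (ns ` {1..p})"
  shows "D_const p ns k =
    (\<Prod>\<alpha>=1..p. qfact (q_ind ^ (k + 1)) (ns \<alpha>))
    * (qfact q_ind (k * n + M) / qfact q_ind k ^ n)
    * ((1 - q_ind) ^ M / (\<Prod>i=1..M. 1 - q_ind ^ i * q_ind ^ (k * (n - m_sum p ns i))))"
proof -
  let ?V = "{0<..start ns (Suc p)}"
  have n: "start ns (Suc p) = n"
    using assms(4) by (simp add: start_def lessThan_Suc_atMost)
  have lay: "layers (label ns) ?V i = n - m_sum p ns i" if "1 \<le> i" for i
    using layers_label[OF that, of ns p] unfolding n .
  \<comment> \<open>The bound \<open>Suc M\<close> gives the factorial and the range of the product
    the shape required by the theorem.\<close>
  have "CT (wt k (label ns) ?V) = closed_form k (label ns) ?V (Suc M)"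
  proof (rule CT_wt_closed_form)
    fix v assume "v \<in> ?V"
    then show "rank (label ns) ?V v < Suc M"
    proof (cases rule: index_cases)
      case 1
      then show ?thesis using rank_label_single by simp
    next
      case (2 \<alpha>)
      then have "ns \<alpha> \<le> M" using assms(5) by simp
      then show ?thesis
        unfolding rank_label_block[OF 2] using 2 by (auto simp: block_eq start_Suc)
    qed
  qed (use assms(2) in simp_all)
  also have "closed_form k (label ns) ?V (Suc M) = qfact q_ind (k * n + M) / qfact q_ind k ^ n
      / (\<Prod>i=1..M. qnum q_ind (k * (n - m_sum p ns i) + i))"
  proof -
    have "(\<Prod>i\<in>{1..<Suc M}. qnum q_ind (k * layers (label ns) ?V i + i))
        = (\<Prod>i=1..M. qnum q_ind (k * (n - m_sum p ns i) + i))"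
      by (intro prod.cong) (auto simp: lay)
    then show ?thesis unfolding closed_form_def by (simp add: n)
  qed
  also have "(\<Prod>i=1..M. qnum q_ind (k * (n - m_sum p ns i) + i))
      = (\<Prod>i=1..M. 1 - q_ind ^ i * q_ind ^ (k * (n - m_sum p ns i))) / (1 - q_ind) ^ M"
    by (simp add: qnum_def prod_dividef power_add mult_ac)
  finally show ?thesis
    unfolding D_const_eq by (simp add: mult_ac)
qed

end
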